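(* Let $\underline R$ be a commutative square ring, and let $f:(M,A)\to(N,B)$ and $g:(N,B)\to(L,C)$ be two $\underline R$-CP-quadratic maps. Then the map $$f^*:\underline R\text{-}\mathsf{Quad}((N,B),(L,C))\to\underline R\text{-}\mathsf{Quad}((M,A),(L,C)),\qquad h\mapsto h\circ f,$$ is $\underline R$-CP-linear, and the map $$g_*:\underline R\text{-}\mathsf{Quad}((M,A),(N,B))\to\underline R\text{-}\mathsf{Quad}((M,A),(L,C)),\qquad h\mapsto g\circ h,$$ is $\underline R$-CP-quadratic.
   Context: A square ring $\underline R=(R_e\xrightarrow{H}R_{ee}\xrightarrow{P}R_e)$ consists of: a set $R_e$ with a group structure $+$ (not necessarily commutative) and an associative unital multiplication satisfying $r(s+t)=rs+rt$ (the law $(r+s)t=rt+st$ is not required); an abelian group $R_{ee}$; a map $R_e\times R_e\times R_{ee}\times R_e\to R_{ee}$, $(r,s,x,t)\mapsto(r,s)\cdot x\cdot t$, additive in each of its four variables and defining commuting actions on $R_{ee}$ of the multiplicative monoids $R_e\times R_e$ (on the left) and $R_e$ (on the right) (write $(r,s)\cdot x$ if $t=1$ and $x\cdot t$ if $r=s=1$); a group homomorphism $T:R_{ee}\to R_{ee}$ with $T^2=\mathrm{Id}$; a map $H:R_e\to R_{ee}$ and a group homomorphism $P:R_{ee}\to R_e$; such that for all $r,s,t\in R_e$, $x,y\in R_{ee}$: $PHP=P+P$; $P((r,r)\cdot x\cdot s)=rP(x)s$; $T=HP-\mathrm{Id}$; $PT=P$; $(P(x),r)\cdot y=(r,P(x))\cdot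 y=0=y\cdot P(x)$; $H(r+s)=H(r)+H(s)+(s,r)\cdot H(2)$ where $2=1+1$; $H(rs)=(r,r)\cdot H(s)+H(r)\cdot s$; $(r+s)t=rt+st+P((r,s)\cdot H(t))$; $T((r,s)\cdot x\cdot t)=(s,r)\cdot T(x)\cdot t$. The quotient $\overline R=R_e/\operatorname{Im}P$ is a ring. $\underline R$ is commutative if $\overline R$ is commutative and $(r,1)\cdot x=(1,r)\cdot x=x\cdot r$ for all $r\in R_e$, $x\in R_{ee}$. A (right) $\underline R$-BHP-module is a group $M$ (written additively, not necessarily commutative) with operations $M\times R_e\to M$, $(m,r)\mapsto m\cdot r$ and $M\times M\times R_{ee}\to M$, $(m,n,x)\mapsto[m,n]\cdot x$ such that: $m\cdot1=m$, $(m\cdot r)\cdot s=m\cdot(rs)$, $m\cdot(r+s)=m\cdot r+m\cdot s$; $(m+n)\cdot r=m\cdot r+n\cdot r+[m,n]\cdot H(r)$; $m\cdot P(x)=[m,m]\cdot x$; $[m,n]\cdot T(x)=[n,m]\cdot x$; $[m,n]\cdot x$ is additive in each of $m,n,x$; $([m\cdot r,n\cdot s]\cdot x)\cdot t=[m,n]\cdot((r,s)\cdot x\cdot t)$; $[[m,m']\cdot x,n]\cdot y=0$. An $\underline R$-CP-module is a pair $(M,A)$ where $M$ is an $\underline R$-BHP-module and $A$ is a subgroup of $M$, stable under the action of $R_e$, such that $[m,n]\cdot x=0$ whenever $m\in A$, and $[m,n]\cdot x\in A$ for all $m,n\in M$, $x\in R_{ee}$. A map between BHP-modules is $\underline R$-linear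 if it is additive and commutes with the operations $\cdot r$ ($r\in R_e$) and $[-,-]\cdot x$ ($x\in R_{ee}$); a map $M\times M\to N$ is $\underline R$-bilinear if it is $\underline R$-linear in each variable separately. A map $\alpha:(M,A)\to(N,B)$ of CP-modules is $\underline R$-CP-linear if $\alpha:M\to N$ is $\underline R$-linear and $\alpha(A)\subseteq B$. For a map $f:M\to N$ of BHP-modules put $d_f(m,m')=f(m+m')-f(m')-f(m)$; $f_{(r)}(m)=f(m\cdot r)-f(m)\cdot r$ for $r\in R_e$; $f_{[x]}(m,m')=f([m,m']\cdot x)-[f(m),f(m')]\cdot x$ for $x\in R_{ee}$. For a map $g$ from a set to a BHP-module $N$, $\operatorname{Im}_{\underline R}g$ is the smallest subgroup of $N$ containing the image of $g$ and stable under the operations of $R_e$ and $R_{ee}$. For $\underline R$ commutative, a map $f:(M,A)\to(N,B)$ of $\underline R$-CP-modules (i.e. a map $f:M\to N$) is $\underline R$-CP-quadratic if: (1) $f(A)$, $\operatorname{Im}_{\underline R}d_f$, $\operatorname{Im}_{\underline R}f_{(r)}$, $\operatorname{Im}_{\underline R}f_{[x]}$ are contained in $B$ for all $r\in R_e,x\in R_{ee}$; (2) $d_f$ and all $f_{[x]}$ are $\underline R$-bilinear; (3) $f_{(r)}(m\cdot s)=f_{(r)}(m)\cdot s^2$ for all $m\in M$, $r,s\in R_e$; (4) $d_f(M,A)=d_f(A,M)=0$, $f_{(r)}(A)=0$, $f_{[x]}(M,A)=f_{[x]}(A,M)=0$ for all $r,x$. For $\underline R$-CP-modules $(M,A),(N,B)$,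 $\underline R\text{-}\mathsf{Quad}((M,A),(N,B))$ denotes the $\underline R$-CP-module whose first member is the group of all $\underline R$-CP-quadratic maps $(M,A)\to(N,B)$ and whose second member is the subgroup of all $\underline R$-CP-quadratic maps $(M,A)\to(B,0)$, all operations being pointwise: $(f+g)(m)=f(m)+g(m)$, $(f\cdot r)(m)=f(m)\cdot r$, $([f,g]\cdot x)(m)=[f(m),g(m)]\cdot x$.
   Formalization: The second member of Quad((M,A),(N,B)) is taken as the CP-quadratic maps h:(M,A)→(N,B) with h(M)⊆B and h(A)=0; reading (B,0) literally as the target forces h to be linear, so Quad need not be a CP-module and the claim on g_* fails (e.g. g(n)=n² over Z). *)

theory Defs
  imports "HOL-Algebra.QuotRing"
begin

text \<open>
  All groups except \<open>R\<^sub>e\<^sub>e\<close> are possibly non-commutative and written additively, so the group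
  underlying a structure \<open>G\<close> is \<open>add_monoid G\<close> and \<open>x \<ominus>\<^bsub>G\<^esub> y\<close> is \<open>x \<oplus>\<^bsub>G\<^esub> (\<ominus>\<^bsub>G\<^esub> y)\<close>.
  The multiplicative fields \<open>mult\<close> and \<open>one\<close> of \<open>ee R\<close> and of BHP-modules are never used;
  they are present only because the additive notation is part of the record \<^type>\<open>ring\<close>
  (as for \<open>module\<close> in \<open>HOL-Algebra\<close>).
\<close>

text \<open>The record itself is \<open>R\<^sub>e\<close>; \<open>act R r s x t\<close> is \<open>(r,s)\<cdot>x\<cdot>t\<close>.\<close>

record ('r, 'x) sqring = "'r ring" +
  ee :: "'x ring"
  act :: "'r \<Rightarrow> 'r \<Rightarrow> 'x \<Rightarrow> 'r \<Rightarrow> 'x"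
  sqT :: "'x \<Rightarrow> 'x"
  sqH :: "'r \<Rightarrow> 'x"
  sqP :: "'x \<Rightarrow> 'r"

abbreviation lact :: "('r, 'x, 'e) sqring_scheme \<Rightarrow> 'r \<Rightarrow> 'r \<Rightarrow> 'x \<Rightarrow> 'x" where
  "lact R r s x \<equiv> act R r s x \<one>\<^bsub>R\<^esub>"

abbreviation ract :: "('r, 'x, 'e) sqring_scheme \<Rightarrow> 'x \<Rightarrow> 'r \<Rightarrow> 'x" where
  "ract R x t \<equiv> act R \<one>\<^bsub>R\<^esub> \<one>\<^bsub>R\<^esub> x t"

locale square_ring =
  fixes R :: "('r, 'x, 'e) sqring_scheme" (structure)
  assumes add_group: "group (add_monoid R)"
    and mult_monoid: "Group.monoid R"
    and left_distrib:
      "\<lbrakk>r \<in> carrier R; s \<in> carrier R; t \<in> carrier R\<rbrakk>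
        \<Longrightarrow> r \<otimes> (s \<oplus> t) = r \<otimes> s \<oplus> r \<otimes> t"
    and ee_group: "abelian_group (ee R)"
    and act_closed:
      "\<lbrakk>r \<in> carrier R; s \<in> carrier R; x \<in> carrier (ee R); t \<in> carrier R\<rbrakk>
        \<Longrightarrow> act R r s x t \<in> carrier (ee R)"
    and act_add1:
      "\<lbrakk>r \<in> carrier R; r' \<in> carrier R; s \<in> carrier R; x \<in> carrier (ee R); t \<in> carrier R\<rbrakk>
        \<Longrightarrow> act R (r \<oplus> r') s x t = act R r s x t \<oplus>\<^bsub>ee R\<^esub> act R r' s x t"
    and act_add2:
      "\<lbrakk>r \<in> carrier R; s \<in> carrier R; s' \<in> carrier R; x \<in> carrier (ee R); t \<in> carrier R\<rbrakk>
        \<Longrightarrow> act R r (s \<oplus> s') x t = act R r s x t \<oplus>\<^bsub>ee R\<^esub> act R r s' x t"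
    and act_add3:
      "\<lbrakk>r \<in> carrier R; s \<in> carrier R; x \<in> carrier (ee R); x' \<in> carrier (ee R); t \<in> carrier R\<rbrakk>
        \<Longrightarrow> act R r s (x \<oplus>\<^bsub>ee R\<^esub> x') t = act R r s x t \<oplus>\<^bsub>ee R\<^esub> act R r s x' t"
    and act_add4:
      "\<lbrakk>r \<in> carrier R; s \<in> carrier R; x \<in> carrier (ee R); t \<in> carrier R; t' \<in> carrier R\<rbrakk>
        \<Longrightarrow> act R r s x (t \<oplus> t') = act R r s x t \<oplus>\<^bsub>ee R\<^esub> act R r s x t'"
    and act_one: "x \<in> carrier (ee R) \<Longrightarrow> act R \<one> \<one> x \<one> = x"
    and lact_mult:
      "\<lbrakk>r \<in> carrier R; s \<in> carrier R; r' \<in> carrier R; s' \<in> carrier R; x \<in> carrier (ee R)\<rbrakk>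
        \<Longrightarrow> lact R r s (lact R r' s' x) = lact R (r \<otimes> r') (s \<otimes> s') x"
    and ract_mult:
      "\<lbrakk>x \<in> carrier (ee R); t \<in> carrier R; t' \<in> carrier R\<rbrakk>
        \<Longrightarrow> ract R (ract R x t) t' = ract R x (t \<otimes> t')"
    and act_lact_ract:
      "\<lbrakk>r \<in> carrier R; s \<in> carrier R; x \<in> carrier (ee R); t \<in> carrier R\<rbrakk>
        \<Longrightarrow> act R r s x t = lact R r s (ract R x t)"
    and act_ract_lact:
      "\<lbrakk>r \<in> carrier R; s \<in> carrier R; x \<in> carrier (ee R); t \<in> carrier R\<rbrakk>
        \<Longrightarrow> act R r s x t = ract R (lact R r s x) t"
    and T_hom: "sqT R \<in> hom (add_monoid (ee R)) (add_monoid (ee R))"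
    and T_T: "x \<in> carrier (ee R) \<Longrightarrow> sqT R (sqT R x) = x"
    and H_closed: "sqH R \<in> carrier R \<rightarrow> carrier (ee R)"
    and P_hom: "sqP R \<in> hom (add_monoid (ee R)) (add_monoid R)"
    and PHP: "x \<in> carrier (ee R) \<Longrightarrow> sqP R (sqH R (sqP R x)) = sqP R x \<oplus> sqP R x"
    and P_act:
      "\<lbrakk>r \<in> carrier R; x \<in> carrier (ee R); s \<in> carrier R\<rbrakk>
        \<Longrightarrow> sqP R (act R r r x s) = r \<otimes> sqP R x \<otimes> s"
    and T_eq: "x \<in> carrier (ee R) \<Longrightarrow> sqT R x = sqH R (sqP R x) \<ominus>\<^bsub>ee R\<^esub> x"
    and P_T: "x \<in> carrier (ee R) \<Longrightarrow> sqP R (sqT R x) = sqP R x"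
    and lact_P1:
      "\<lbrakk>x \<in> carrier (ee R); r \<in> carrier R; y \<in> carrier (ee R)\<rbrakk>
        \<Longrightarrow> lact R (sqP R x) r y = \<zero>\<^bsub>ee R\<^esub>"
    and lact_P2:
      "\<lbrakk>x \<in> carrier (ee R); r \<in> carrier R; y \<in> carrier (ee R)\<rbrakk>
        \<Longrightarrow> lact R r (sqP R x) y = \<zero>\<^bsub>ee R\<^esub>"
    and ract_P:
      "\<lbrakk>x \<in> carrier (ee R); y \<in> carrier (ee R)\<rbrakk> \<Longrightarrow> ract R y (sqP R x) = \<zero>\<^bsub>ee R\<^esub>"
    and H_add:
      "\<lbrakk>r \<in> carrier R; s \<in> carrier R\<rbrakk>
        \<Longrightarrow> sqH R (r \<oplus> s) = sqH R r \<oplus>\<^bsub>ee R\<^esub> sqH R s \<oplus>\<^bsub>ee R\<^esub> lact R s r (sqH R (\<one> \<oplus> \<one>))"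
    and H_mult:
      "\<lbrakk>r \<in> carrier R; s \<in> carrier R\<rbrakk>
        \<Longrightarrow> sqH R (r \<otimes> s) = lact R r r (sqH R s) \<oplus>\<^bsub>ee R\<^esub> ract R (sqH R r) s"
    and right_distrib:
      "\<lbrakk>r \<in> carrier R; s \<in> carrier R; t \<in> carrier R\<rbrakk>
        \<Longrightarrow> (r \<oplus> s) \<otimes> t = r \<otimes> t \<oplus> s \<otimes> t \<oplus> sqP R (lact R r s (sqH R t))"
    and T_act:
      "\<lbrakk>r \<in> carrier R; s \<in> carrier R; x \<in> carrier (ee R); t \<in> carrier R\<rbrakk>
        \<Longrightarrow> sqT R (act R r s x t) = act R s r (sqT R x) t"

definition sqbar :: "('r, 'x, 'e) sqring_scheme \<Rightarrow> 'r set ring" where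
  "sqbar R = R Quot (sqP R ` carrier (ee R))"

locale comm_square_ring = square_ring +
  assumes bar_comm: "cring (sqbar R)"
    and lact_comm: "\<lbrakk>r \<in> carrier R; x \<in> carrier (ee R)\<rbrakk> \<Longrightarrow> lact R r \<one> x = lact R \<one> r x"
    and lact_ract: "\<lbrakk>r \<in> carrier R; x \<in> carrier (ee R)\<rbrakk> \<Longrightarrow> lact R \<one> r x = ract R x r"


text \<open>\<open>mact M m r\<close> is \<open>m\<cdot>r\<close> and \<open>mbr M m n x\<close> is \<open>[m,n]\<cdot>x\<close>.\<close>

record ('m, 'r, 'x) bhp = "'m ring" +
  mact :: "'m \<Rightarrow> 'r \<Rightarrow> 'm"
  mbr :: "'m \<Rightarrow> 'm \<Rightarrow> 'x \<Rightarrow> 'm"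

locale bhp_module = square_ring R
  for R :: "('r, 'x, 'e) sqring_scheme" (structure) +
  fixes M :: "('m, 'r, 'x, 'f) bhp_scheme"
  assumes M_group: "group (add_monoid M)"
    and mact_closed: "\<lbrakk>m \<in> carrier M; r \<in> carrier R\<rbrakk> \<Longrightarrow> mact M m r \<in> carrier M"
    and mbr_closed:
      "\<lbrakk>m \<in> carrier M; n \<in> carrier M; x \<in> carrier (ee R)\<rbrakk> \<Longrightarrow> mbr M m n x \<in> carrier M"
    and mact_one: "m \<in> carrier M \<Longrightarrow> mact M m \<one> = m"
    and mact_mult:
      "\<lbrakk>m \<in> carrier M; r \<in> carrier R; s \<in> carrier R\<rbrakk>
        \<Longrightarrow> mact M (mact M m r) s = mact M m (r \<otimes> s)"
    and mact_add:
      "\<lbrakk>m \<in> carrier M; r \<in> carrier R; s \<in> carrier R\<rbrakk>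
        \<Longrightarrow> mact M m (r \<oplus> s) = mact M m r \<oplus>\<^bsub>M\<^esub> mact M m s"
    and add_mact:
      "\<lbrakk>m \<in> carrier M; n \<in> carrier M; r \<in> carrier R\<rbrakk>
        \<Longrightarrow> mact M (m \<oplus>\<^bsub>M\<^esub> n) r = mact M m r \<oplus>\<^bsub>M\<^esub> mact M n r \<oplus>\<^bsub>M\<^esub> mbr M m n (sqH R r)"
    and mact_P:
      "\<lbrakk>m \<in> carrier M; x \<in> carrier (ee R)\<rbrakk> \<Longrightarrow> mact M m (sqP R x) = mbr M m m x"
    and mbr_T:
      "\<lbrakk>m \<in> carrier M; n \<in> carrier M; x \<in> carrier (ee R)\<rbrakk>
        \<Longrightarrow> mbr M m n (sqT R x) = mbr M n m x"
    and mbr_add1: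
      "\<lbrakk>m \<in> carrier M; m' \<in> carrier M; n \<in> carrier M; x \<in> carrier (ee R)\<rbrakk>
        \<Longrightarrow> mbr M (m \<oplus>\<^bsub>M\<^esub> m') n x = mbr M m n x \<oplus>\<^bsub>M\<^esub> mbr M m' n x"
    and mbr_add2:
      "\<lbrakk>m \<in> carrier M; n \<in> carrier M; n' \<in> carrier M; x \<in> carrier (ee R)\<rbrakk>
        \<Longrightarrow> mbr M m (n \<oplus>\<^bsub>M\<^esub> n') x = mbr M m n x \<oplus>\<^bsub>M\<^esub> mbr M m n' x"
    and mbr_add3:
      "\<lbrakk>m \<in> carrier M; n \<in> carrier M; x \<in> carrier (ee R); x' \<in> carrier (ee R)\<rbrakk>
        \<Longrightarrow> mbr M m n (x \<oplus>\<^bsub>ee R\<^esub> x') = mbr M m n x \<oplus>\<^bsub>M\<^esub> mbr M m n x'"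
    and mbr_act:
      "\<lbrakk>m \<in> carrier M; n \<in> carrier M; r \<in> carrier R; s \<in> carrier R;
        x \<in> carrier (ee R); t \<in> carrier R\<rbrakk>
        \<Longrightarrow> mact M (mbr M (mact M m r) (mact M n s) x) t = mbr M m n (act R r s x t)"
    and mbr_mbr:
      "\<lbrakk>m \<in> carrier M; m' \<in> carrier M; n \<in> carrier M; x \<in> carrier (ee R); y \<in> carrier (ee R)\<rbrakk>
        \<Longrightarrow> mbr M (mbr M m m' x) n y = \<zero>\<^bsub>M\<^esub>"

fun cp_module ::
  "('r, 'x, 'e) sqring_scheme \<Rightarrow> ('m, 'r, 'x, 'f) bhp_scheme \<times> 'm set \<Rightarrow> bool" where
  "cp_module R (M, A) \<longleftrightarrow>
     bhp_module R M \<and>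
     additive_subgroup A M \<and>
     (\<forall>a\<in>A. \<forall>r\<in>carrier R. mact M a r \<in> A) \<and>
     (\<forall>a\<in>A. \<forall>n\<in>carrier M. \<forall>x\<in>carrier (ee R). mbr M a n x = \<zero>\<^bsub>M\<^esub>) \<and>
     (\<forall>m\<in>carrier M. \<forall>n\<in>carrier M. \<forall>x\<in>carrier (ee R). mbr M m n x \<in> A)"

definition sq_linear ::
  "('r, 'x, 'e) sqring_scheme \<Rightarrow> ('m, 'r, 'x, 'f) bhp_scheme \<Rightarrow> ('n, 'r, 'x, 'g) bhp_scheme
    \<Rightarrow> ('m \<Rightarrow> 'n) \<Rightarrow> bool" where
  "sq_linear R M N f \<longleftrightarrow>
     f \<in> hom (add_monoid M) (add_monoid N) \<and>
     (\<forall>m\<in>carrier M. \<forall>r\<in>carrier R. f (mact M m r) = mact N (f m) r) \<and>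
     (\<forall>m\<in>carrier M. \<forall>m'\<in>carrier M. \<forall>x\<in>carrier (ee R).
        f (mbr M m m' x) = mbr N (f m) (f m') x)"

definition sq_bilinear ::
  "('r, 'x, 'e) sqring_scheme \<Rightarrow> ('m, 'r, 'x, 'f) bhp_scheme \<Rightarrow> ('n, 'r, 'x, 'g) bhp_scheme
    \<Rightarrow> ('m \<Rightarrow> 'm \<Rightarrow> 'n) \<Rightarrow> bool" where
  "sq_bilinear R M N b \<longleftrightarrow>
     (\<forall>m\<in>carrier M. sq_linear R M N (\<lambda>m'. b m m') \<and> sq_linear R M N (\<lambda>m'. b m' m))"

fun cp_linear ::
  "('r, 'x, 'e) sqring_scheme \<Rightarrow> ('m, 'r, 'x, 'f) bhp_scheme \<times> 'm set
    \<Rightarrow> ('n, 'r, 'x, 'g) bhp_scheme \<times> 'n set \<Rightarrow> ('m \<Rightarrow> 'n) \<Rightarrow> bool" where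
  "cp_linear R (M, A) (N, B) f \<longleftrightarrow>
     cp_module R (M, A) \<and> cp_module R (N, B) \<and> sq_linear R M N f \<and> f ` A \<subseteq> B"

definition dev ::
  "('m, 'r, 'x, 'f) bhp_scheme \<Rightarrow> ('n, 'r, 'x, 'g) bhp_scheme \<Rightarrow> ('m \<Rightarrow> 'n) \<Rightarrow> 'm \<Rightarrow> 'm \<Rightarrow> 'n" where
  "dev M N f m m' = f (m \<oplus>\<^bsub>M\<^esub> m') \<ominus>\<^bsub>N\<^esub> f m' \<ominus>\<^bsub>N\<^esub> f m"

definition dev_act ::
  "('m, 'r, 'x, 'f) bhp_scheme \<Rightarrow> ('n, 'r, 'x, 'g) bhp_scheme \<Rightarrow> ('m \<Rightarrow> 'n) \<Rightarrow> 'r \<Rightarrow> 'm \<Rightarrow> 'n" where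
  "dev_act M N f r m = f (mact M m r) \<ominus>\<^bsub>N\<^esub> mact N (f m) r"

definition dev_br ::
  "('m, 'r, 'x, 'f) bhp_scheme \<Rightarrow> ('n, 'r, 'x, 'g) bhp_scheme \<Rightarrow> ('m \<Rightarrow> 'n) \<Rightarrow> 'x
    \<Rightarrow> 'm \<Rightarrow> 'm \<Rightarrow> 'n" where
  "dev_br M N f x m m' = f (mbr M m m' x) \<ominus>\<^bsub>N\<^esub> mbr N (f m) (f m') x"

text \<open>\<open>Im\<^sub>R g\<close> is \<open>sq_span R N\<close> of the image of \<open>g\<close>.\<close>

definition sq_span ::
  "('r, 'x, 'e) sqring_scheme \<Rightarrow> ('n, 'r, 'x, 'g) bhp_scheme \<Rightarrow> 'n set \<Rightarrow> 'n set" where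
  "sq_span R N S = \<Inter>{U. additive_subgroup U N \<and> S \<subseteq> U \<and>
     (\<forall>u\<in>U. \<forall>r\<in>carrier R. mact N u r \<in> U) \<and>
     (\<forall>u\<in>U. \<forall>v\<in>U. \<forall>x\<in>carrier (ee R). mbr N u v x \<in> U)}"

fun cp_quadratic ::
  "('r, 'x, 'e) sqring_scheme \<Rightarrow> ('m, 'r, 'x, 'f) bhp_scheme \<times> 'm set
    \<Rightarrow> ('n, 'r, 'x, 'g) bhp_scheme \<times> 'n set \<Rightarrow> ('m \<Rightarrow> 'n) \<Rightarrow> bool" where
  "cp_quadratic R (M, A) (N, B) f \<longleftrightarrow>
     cp_module R (M, A) \<and> cp_module R (N, B) \<and> f \<in> carrier M \<rightarrow> carrier N \<and>
     f ` A \<subseteq> B \<and>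
     sq_span R N ((\<lambda>(m, m'). dev M N f m m') ` (carrier M \<times> carrier M)) \<subseteq> B \<and>
     (\<forall>r\<in>carrier R. sq_span R N (dev_act M N f r ` carrier M) \<subseteq> B) \<and>
     (\<forall>x\<in>carrier (ee R).
        sq_span R N ((\<lambda>(m, m'). dev_br M N f x m m') ` (carrier M \<times> carrier M)) \<subseteq> B) \<and>
     sq_bilinear R M N (dev M N f) \<and>
     (\<forall>x\<in>carrier (ee R). sq_bilinear R M N (dev_br M N f x)) \<and>
     (\<forall>m\<in>carrier M. \<forall>r\<in>carrier R. \<forall>s\<in>carrier R.
        dev_act M N f r (mact M m s) = mact N (dev_act M N f r m) (s \<otimes>\<^bsub>R\<^esub> s)) \<and>
     (\<forall>m\<in>carrier M. \<forall>a\<in>A. dev M N f m a = \<zero>\<^bsub>N\<^esub> \<and> dev M N f a m = \<zero>\<^bsub>N\<^esub>) \<and>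
     (\<forall>r\<in>carrier R. \<forall>a\<in>A. dev_act M N f r a = \<zero>\<^bsub>N\<^esub>) \<and>
     (\<forall>x\<in>carrier (ee R). \<forall>m\<in>carrier M. \<forall>a\<in>A.
        dev_br M N f x m a = \<zero>\<^bsub>N\<^esub> \<and> dev_br M N f x a m = \<zero>\<^bsub>N\<^esub>)"

text \<open>
  Maps \<open>M \<rightarrow> N\<close> are represented as functions that are \<^const>\<open>undefined\<close> outside \<open>carrier M\<close>,
  so that equality of elements is equality of maps.
\<close>

fun quad_carrier ::
  "('r, 'x, 'e) sqring_scheme \<Rightarrow> ('m, 'r, 'x, 'f) bhp_scheme \<times> 'm set
    \<Rightarrow> ('n, 'r, 'x, 'g) bhp_scheme \<times> 'n set \<Rightarrow> ('m \<Rightarrow> 'n) set" where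
  "quad_carrier R (M, A) (N, B) = {f \<in> extensional (carrier M). cp_quadratic R (M, A) (N, B) f}"

text \<open>
  The second member consists of the quadratic maps \<open>(M,A) \<rightarrow> (N,B)\<close> that map the pair \<open>(M,A)\<close>
  into the pair \<open>(B,0)\<close>. The deviations of such a map take values in \<open>B\<close>; they are not required
  to vanish, as they would be if \<open>(B,0)\<close> were also used as the target in
  \<^const>\<open>cp_quadratic\<close>. The stronger requirement would leave only linear maps, which do not in
  general contain the maps \<open>[f,g]\<cdot>x\<close>, so the pair would not be a CP-module.
\<close>

fun Quad ::
  "('r, 'x, 'e) sqring_scheme \<Rightarrow> ('m, 'r, 'x, 'f) bhp_scheme \<times> 'm set
    \<Rightarrow> ('n, 'r, 'x, 'g) bhp_scheme \<times> 'n set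
    \<Rightarrow> ('m \<Rightarrow> 'n, 'r, 'x) bhp \<times> ('m \<Rightarrow> 'n) set" where
  "Quad R (M, A) (N, B) =
     (\<lparr>carrier = quad_carrier R (M, A) (N, B),
       monoid.mult = undefined,
       one = undefined,
       zero = (\<lambda>m\<in>carrier M. \<zero>\<^bsub>N\<^esub>),
       add = (\<lambda>f g. \<lambda>m\<in>carrier M. f m \<oplus>\<^bsub>N\<^esub> g m),
       mact = (\<lambda>f r. \<lambda>m\<in>carrier M. mact N (f m) r),
       mbr = (\<lambda>f g x. \<lambda>m\<in>carrier M. mbr N (f m) (g m) x)\<rparr>,
      {f \<in> quad_carrier R (M, A) (N, B). f ` carrier M \<subseteq> B \<and> f ` A \<subseteq> {\<zero>\<^bsub>N\<^esub>}})"

end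

theory Submission
  imports Defs
begin

text \<open>
  In a CP-module \<open>(M,A)\<close> the subgroup \<open>A\<close> is central, and \<open>Im P\<close> acts on it trivially, so that
  \<open>A\<close> is a module over the commutative ring \<open>R\<^sub>e / Im P\<close>. A map \<open>f\<close> is therefore CP-quadratic
  iff it preserves \<open>+\<close>, \<open>\<cdot>r\<close> and \<open>[-,-]\<cdot>x\<close> up to summands in \<open>B\<close> that are bilinear, homogeneous
  of degree 2 and bilinear, respectively, and that vanish on \<open>A\<close>. Such error terms are closed under
  sums, under the action of \<open>R\<close>, and under composition with quadratic maps on either side, and the
  commutator \<open>[g m, f n]\<cdot>H(2)\<close> is again one. Hence the \<open>Quad\<close> groups are CP-modules
  and composites are quadratic. The deviations of \<open>h \<mapsto> g \<circ> h\<close> are those of \<open>g\<close>, evaluated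
  pointwise.
\<close>

lemma (in square_ring) P_closed: "x \<in> carrier (ee R) \<Longrightarrow> sqP R x \<in> carrier R"
  using P_hom by (auto simp: hom_def)

lemma (in square_ring) P_mult_left:
  assumes "r \<in> carrier R" "x \<in> carrier (ee R)"
  shows "r \<otimes> sqP R x \<in> sqP R ` carrier (ee R)" "sqP R x \<otimes> r \<in> sqP R ` carrier (ee R)"
proof -
  interpret Group.monoid R by (rule mult_monoid)
  have "sqP R (act R r r x \<one>) = r \<otimes> sqP R x" "sqP R (act R \<one> \<one> x r) = sqP R x \<otimes> r"
    using assms P_closed by (simp_all add: P_act)
  then show "r \<otimes> sqP R x \<in> sqP R ` carrier (ee R)" "sqP R x \<otimes> r \<in> sqP R ` carrier (ee R)"
    using assms by (metis act_closed one_closed imageI)+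
qed

context square_ring
begin

lemma R_add_closed: "\<lbrakk>r \<in> carrier R; s \<in> carrier R\<rbrakk> \<Longrightarrow> r \<oplus> s \<in> carrier R"
  using group.is_monoid[OF add_group] monoid.m_closed by fastforce

lemma R_mult_closed: "\<lbrakk>r \<in> carrier R; s \<in> carrier R\<rbrakk> \<Longrightarrow> r \<otimes> s \<in> carrier R"
  using mult_monoid monoid.m_closed by metis

lemma R_one_closed: "\<one> \<in> carrier R"
  using mult_monoid monoid.one_closed by metis

lemma R_zero_closed: "\<zero> \<in> carrier R"
  using group.is_monoid[OF add_group] monoid.one_closed by fastforce

lemma R_minus_closed: "r \<in> carrier R \<Longrightarrow> \<ominus> r \<in> carrier R"
  using group.inv_closed[OF add_group] by (simp add: a_inv_def)

lemma R_zero_add: "\<zero> \<oplus> \<zero> = \<zero>"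
  using group.is_monoid[OF add_group] monoid.l_one monoid.one_closed by fastforce

lemma R_minus_one: "\<one> \<oplus> \<ominus> \<one> = \<zero>"
  using group.r_inv[OF add_group, of \<one>] R_one_closed by (simp add: a_inv_def)

lemma R_add_assoc:
  "\<lbrakk>r \<in> carrier R; s \<in> carrier R; t \<in> carrier R\<rbrakk> \<Longrightarrow> r \<oplus> s \<oplus> t = r \<oplus> (s \<oplus> t)"
  using monoid.m_assoc[OF group.is_monoid[OF add_group]] by simp

lemma ee_add_closed:
  "\<lbrakk>x \<in> carrier (ee R); y \<in> carrier (ee R)\<rbrakk> \<Longrightarrow> x \<oplus>\<^bsub>ee R\<^esub> y \<in> carrier (ee R)"
  by (simp add: ee_group abelian_groupE(1))

lemma H_in: "r \<in> carrier R \<Longrightarrow> sqH R r \<in> carrier (ee R)"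
  using H_closed by blast

lemma P_add:
  "\<lbrakk>x \<in> carrier (ee R); y \<in> carrier (ee R)\<rbrakk> \<Longrightarrow> sqP R (x \<oplus>\<^bsub>ee R\<^esub> y) = sqP R x \<oplus> sqP R y"
  using P_hom by (auto simp: hom_def)

end

lemma (in comm_square_ring) mult_commute_mod_P:
  assumes r: "r \<in> carrier R" and s: "s \<in> carrier R"
  shows "\<exists>x\<in>carrier (ee R). \<exists>y\<in>carrier (ee R). r \<otimes> s = sqP R x \<oplus> s \<otimes> r \<oplus> sqP R y"
proof -
  let ?I = "sqP R ` carrier (ee R)"
  note cl = R_add_closed R_mult_closed P_closed
  have "\<zero>\<^bsub>ee R\<^esub> \<in> carrier (ee R)"
    using ee_group abelian_groupE(2) by blast
  moreover have "sqP R \<zero>\<^bsub>ee R\<^esub> = \<zero>"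
    using group_hom.hom_one[of "add_monoid (ee R)" "add_monoid R" "sqP R"] P_hom add_group
      abelian_group.a_group[OF ee_group] by (simp add: group_hom_def group_hom_axioms_def)
  ultimately have I0: "\<zero> \<in> ?I" by force
  have l0: "\<zero> \<oplus> t = t" if "t \<in> carrier R" for t
    using monoid.l_one[OF group.is_monoid[OF add_group]] that by simp
  have self: "t \<in> ?I +> t" if "t \<in> carrier R" for t
    using I0 l0[OF that] unfolding a_r_coset_def' by (metis (mono_tags, lifting) UN_iff singletonI)
  have "?I +> t \<in> carrier (sqbar R)" if "t \<in> carrier R" for t
    using that by (auto simp: sqbar_def FactRing_def A_RCOSETS_def')
  then have "[mod ?I:] (?I +> r) \<Otimes> (?I +> s) = [mod ?I:] (?I +> s) \<Otimes> (?I +> r)"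
    using comm_monoid.m_comm[of "sqbar R" "?I +> r" "?I +> s"] bar_comm r s
    by (simp add: cring_def sqbar_def FactRing_def)
  moreover have "r \<otimes> s \<in> [mod ?I:] (?I +> r) \<Otimes> (?I +> s)"
    unfolding rcoset_mult_def using self r s R_mult_closed by (metis (mono_tags, lifting) UN_iff)
  ultimately obtain a b where ab: "b \<in> ?I +> s" "a \<in> ?I +> r" "r \<otimes> s \<in> ?I +> (b \<otimes> a)"
    by (auto simp: rcoset_mult_def)
  then obtain x y z where xyz: "x \<in> carrier (ee R)" "y \<in> carrier (ee R)" "z \<in> carrier (ee R)"
    "b = sqP R y \<oplus> s" "a = sqP R z \<oplus> r" "r \<otimes> s = sqP R x \<oplus> b \<otimes> a"
    by (auto simp: a_r_coset_def')
  have b: "b \<in> carrier R" using xyz s cl by auto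
  obtain u where u: "u \<in> carrier (ee R)" "b \<otimes> sqP R z = sqP R u"
    using P_mult_left(1)[OF b xyz(3)] by blast
  obtain v where v: "v \<in> carrier (ee R)" "sqP R y \<otimes> r = sqP R v"
    using P_mult_left(2)[OF r xyz(2)] by blast
  define w where "w = lact R (sqP R y) s (sqH R r)"
  have w: "w \<in> carrier (ee R)"
    using xyz r s act_closed P_closed H_in R_one_closed unfolding w_def by blast
  have "b \<otimes> a = sqP R u \<oplus> b \<otimes> r"
    using xyz u b r cl left_distrib by simp
  also have "b \<otimes> r = sqP R v \<oplus> s \<otimes> r \<oplus> sqP R w"
    using xyz v r s cl right_distrib unfolding w_def by simp
  finally have "r \<otimes> s = sqP R (x \<oplus>\<^bsub>ee R\<^esub> (u \<oplus>\<^bsub>ee R\<^esub> v)) \<oplus> s \<otimes> r \<oplus> sqP R w"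
    using xyz u v w r s cl by (simp add: P_add ee_add_closed R_add_assoc)
  then show ?thesis using xyz u v w ee_add_closed by blast
qed

locale cp_mod = comm_square_ring R
  for R :: "('r, 'x, 'e) sqring_scheme" (structure) +
  fixes M :: "('m, 'r, 'x, 'f) bhp_scheme" and A :: "'m set"
  assumes cp: "cp_module R (M, A)"

sublocale cp_mod \<subseteq> bhp_module R M
  using cp by simp

sublocale cp_mod \<subseteq> add: group "add_monoid M"
  rewrites "carrier (add_monoid M) = carrier M"
    and "monoid.mult (add_monoid M) = add M"
    and "one (add_monoid M) = zero M"
    and "m_inv (add_monoid M) = a_inv M"
  by (rule M_group) (simp_all add: a_inv_def)

context cp_mod
begin

lemma A_subgroup: "subgroup A (add_monoid M)"
  using cp by (simp add: additive_subgroup_def)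

lemma A_carrier [simp]: "a \<in> A \<Longrightarrow> a \<in> carrier M"
  using subgroup.mem_carrier[OF A_subgroup] by simp

lemma A_add [simp]: "\<lbrakk>a \<in> A; b \<in> A\<rbrakk> \<Longrightarrow> a \<oplus>\<^bsub>M\<^esub> b \<in> A"
  using subgroup.m_closed[OF A_subgroup] by simp

lemma A_minus [simp]: "a \<in> A \<Longrightarrow> \<ominus>\<^bsub>M\<^esub> a \<in> A"
  using subgroup.m_inv_closed[OF A_subgroup] by (simp add: a_inv_def)

lemma A_zero [simp]: "\<zero>\<^bsub>M\<^esub> \<in> A"
  using subgroup.one_closed[OF A_subgroup] by simp

lemma A_act [simp]: "\<lbrakk>a \<in> A; r \<in> carrier R\<rbrakk> \<Longrightarrow> mact M a r \<in> A"
  using cp by simp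

lemma A_br1 [simp]:
  "\<lbrakk>a \<in> A; m \<in> carrier M; x \<in> carrier (ee R)\<rbrakk> \<Longrightarrow> mbr M a m x = \<zero>\<^bsub>M\<^esub>"
  using cp by simp

lemma A_br2 [simp]:
  "\<lbrakk>a \<in> A; m \<in> carrier M; x \<in> carrier (ee R)\<rbrakk> \<Longrightarrow> mbr M m a x = \<zero>\<^bsub>M\<^esub>"
  using mbr_T[of m a "sqT R x"] A_br1[of a m "sqT R x"] T_hom by (auto simp: hom_def T_T mbr_T)

lemma br_A [simp]:
  "\<lbrakk>m \<in> carrier M; n \<in> carrier M; x \<in> carrier (ee R)\<rbrakk> \<Longrightarrow> mbr M m n x \<in> A"
  using cp by simp

declare mact_closed [simp] mbr_closed [simp] R_add_closed [simp] R_mult_closed [simp]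
  R_one_closed [simp] H_in [simp] P_closed [simp]

lemma left_cancel:
  "\<lbrakk>m \<in> carrier M; n \<in> carrier M; n' \<in> carrier M\<rbrakk>
    \<Longrightarrow> m \<oplus>\<^bsub>M\<^esub> n = m \<oplus>\<^bsub>M\<^esub> n' \<longleftrightarrow> n = n'"
  by (metis add.inv_closed add.l_inv add.l_one add.m_assoc)

text \<open>Compare both expansions of \<open>(m + n)\<cdot>2\<close>.\<close>

lemma add_swap:
  assumes "m \<in> carrier M" "n \<in> carrier M"
  shows "n \<oplus>\<^bsub>M\<^esub> m \<oplus>\<^bsub>M\<^esub> n = m \<oplus>\<^bsub>M\<^esub> n \<oplus>\<^bsub>M\<^esub> n \<oplus>\<^bsub>M\<^esub> mbr M m n (sqH R (\<one> \<oplus> \<one>))"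
proof -
  have "mact M (m \<oplus>\<^bsub>M\<^esub> n) (\<one> \<oplus> \<one>) = m \<oplus>\<^bsub>M\<^esub> n \<oplus>\<^bsub>M\<^esub> (m \<oplus>\<^bsub>M\<^esub> n)"
    using assms by (simp add: mact_add mact_one)
  moreover have "mact M (m \<oplus>\<^bsub>M\<^esub> n) (\<one> \<oplus> \<one>)
      = m \<oplus>\<^bsub>M\<^esub> m \<oplus>\<^bsub>M\<^esub> (n \<oplus>\<^bsub>M\<^esub> n) \<oplus>\<^bsub>M\<^esub> mbr M m n (sqH R (\<one> \<oplus> \<one>))"
    using assms add_mact[of m n "\<one> \<oplus> \<one>"] by (simp add: mact_add[of _ \<one> \<one>] mact_one)
  ultimately have "m \<oplus>\<^bsub>M\<^esub> (n \<oplus>\<^bsub>M\<^esub> m \<oplus>\<^bsub>M\<^esub> n)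
      = m \<oplus>\<^bsub>M\<^esub> (m \<oplus>\<^bsub>M\<^esub> n \<oplus>\<^bsub>M\<^esub> n \<oplus>\<^bsub>M\<^esub> mbr M m n (sqH R (\<one> \<oplus> \<one>)))"
    using assms by (simp add: add.m_assoc)
  then show ?thesis using assms by (simp only: left_cancel add.m_closed mbr_closed H_in R_add_closed R_one_closed)
qed

lemma A_central:
  assumes "a \<in> A" "m \<in> carrier M"
  shows "m \<oplus>\<^bsub>M\<^esub> a = a \<oplus>\<^bsub>M\<^esub> m"
  using add_swap[of a m] assms by simp

lemma A_left_central:
  assumes "a \<in> A" "m \<in> carrier M" "n \<in> carrier M"
  shows "m \<oplus>\<^bsub>M\<^esub> (a \<oplus>\<^bsub>M\<^esub> n) = a \<oplus>\<^bsub>M\<^esub> (m \<oplus>\<^bsub>M\<^esub> n)"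
  using assms A_central by (simp flip: add.m_assoc)

lemma A_commute:
  "\<lbrakk>a \<in> A; b \<in> A\<rbrakk> \<Longrightarrow> a \<oplus>\<^bsub>M\<^esub> b = b \<oplus>\<^bsub>M\<^esub> a"
  by (simp add: A_central)

lemma A_left_commute:
  "\<lbrakk>a \<in> A; b \<in> A; c \<in> A\<rbrakk> \<Longrightarrow> a \<oplus>\<^bsub>M\<^esub> (b \<oplus>\<^bsub>M\<^esub> c) = b \<oplus>\<^bsub>M\<^esub> (a \<oplus>\<^bsub>M\<^esub> c)"
  by (simp add: A_left_central)

lemmas A_ac = add.m_assoc A_commute A_left_commute

lemma commute_br:
  assumes "m \<in> carrier M" "n \<in> carrier M"
  shows "n \<oplus>\<^bsub>M\<^esub> m = m \<oplus>\<^bsub>M\<^esub> n \<oplus>\<^bsub>M\<^esub> mbr M m n (sqH R (\<one> \<oplus> \<one>))"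
proof -
  let ?c = "mbr M m n (sqH R (\<one> \<oplus> \<one>))"
  have "m \<oplus>\<^bsub>M\<^esub> n \<oplus>\<^bsub>M\<^esub> ?c \<oplus>\<^bsub>M\<^esub> n = m \<oplus>\<^bsub>M\<^esub> n \<oplus>\<^bsub>M\<^esub> n \<oplus>\<^bsub>M\<^esub> ?c"
    using assms A_central[of ?c n] add.m_assoc[of "m \<oplus>\<^bsub>M\<^esub> n" ?c n]
      add.m_assoc[of "m \<oplus>\<^bsub>M\<^esub> n" n ?c] by simp
  then have "n \<oplus>\<^bsub>M\<^esub> m \<oplus>\<^bsub>M\<^esub> n = m \<oplus>\<^bsub>M\<^esub> n \<oplus>\<^bsub>M\<^esub> ?c \<oplus>\<^bsub>M\<^esub> n"
    using add_swap[OF assms] by simp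
  then show ?thesis using assms by simp
qed

lemma zero_act [simp]: "r \<in> carrier R \<Longrightarrow> mact M \<zero>\<^bsub>M\<^esub> r = \<zero>\<^bsub>M\<^esub>"
  using add_mact[of "\<zero>\<^bsub>M\<^esub>" "\<zero>\<^bsub>M\<^esub>" r] by simp

lemma act_zero: "m \<in> carrier M \<Longrightarrow> mact M m \<zero> = \<zero>\<^bsub>M\<^esub>"
  using mact_add[of m \<zero> \<zero>] R_zero_closed R_zero_add by simp

lemma act_minus_one: "m \<in> carrier M \<Longrightarrow> mact M m (\<ominus> \<one>) = \<ominus>\<^bsub>M\<^esub> m"
  using mact_add[of m \<one> "\<ominus> \<one>"] R_minus_closed R_minus_one act_zero add.inv_equality
  by (metis R_one_closed mact_closed mact_one add.inv_comm)

lemma add_act_A: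
  "\<lbrakk>m \<in> carrier M; a \<in> A; r \<in> carrier R\<rbrakk>
    \<Longrightarrow> mact M (m \<oplus>\<^bsub>M\<^esub> a) r = mact M m r \<oplus>\<^bsub>M\<^esub> mact M a r"
  by (simp add: add_mact)

lemma br_act1:
  assumes "m \<in> carrier M" "n \<in> carrier M" "x \<in> carrier (ee R)" "r \<in> carrier R"
  shows "mbr M (mact M m r) n x = mact M (mbr M m n x) r"
  using assms mbr_act[of m n r \<one> x \<one>] mbr_act[of m n \<one> \<one> x r] lact_comm lact_ract
  by (simp add: mact_one)

lemma br_act2:
  assumes "m \<in> carrier M" "n \<in> carrier M" "x \<in> carrier (ee R)" "r \<in> carrier R"
  shows "mbr M m (mact M n r) x = mact M (mbr M m n x) r"
  using assms mbr_act[of m n \<one> r x \<one>] mbr_act[of m n \<one> \<one> x r] lact_ract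
  by (simp add: mact_one)

lemma act_commute_br:
  assumes "r \<in> carrier R" "s \<in> carrier R"
  shows "\<exists>x\<in>carrier (ee R). \<forall>m\<in>carrier M.
    mact M (mact M m r) s = mact M (mact M m s) r \<oplus>\<^bsub>M\<^esub> mbr M m m x"
proof -
  obtain x y where xy: "x \<in> carrier (ee R)" "y \<in> carrier (ee R)"
    "r \<otimes> s = sqP R x \<oplus> s \<otimes> r \<oplus> sqP R y"
    using mult_commute_mod_P[OF assms] by blast
  have "mact M (mact M m r) s = mact M (mact M m s) r \<oplus>\<^bsub>M\<^esub> mbr M m m (x \<oplus>\<^bsub>ee R\<^esub> y)"
    if m: "m \<in> carrier M" for m
  proof -
    have "mact M (mact M m r) s = mbr M m m x \<oplus>\<^bsub>M\<^esub> mact M m (s \<otimes> r) \<oplus>\<^bsub>M\<^esub> mbr M m m y"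
      using assms xy m by (simp add: mact_mult mact_add mact_P)
    also have "\<dots> = mact M m (s \<otimes> r) \<oplus>\<^bsub>M\<^esub> mbr M m m x \<oplus>\<^bsub>M\<^esub> mbr M m m y"
      using assms xy m by (simp add: A_central)
    finally show ?thesis
      using assms xy m by (simp add: mact_mult mbr_add3 add.m_assoc)
  qed
  then show ?thesis using xy ee_add_closed by blast
qed

lemma A_act_commute:
  assumes "a \<in> A" "r \<in> carrier R" "s \<in> carrier R"
  shows "mact M (mact M a r) s = mact M (mact M a s) r"
  using act_commute_br[OF assms(2,3)] assms by auto

end


definition cp_bihom ::
  "('r, 'x, 'e) sqring_scheme \<Rightarrow> ('m, 'r, 'x, 'f) bhp_scheme \<Rightarrow> 'm set
    \<Rightarrow> ('n, 'r, 'x, 'g) bhp_scheme \<Rightarrow> 'n set \<Rightarrow> ('m \<Rightarrow> 'm \<Rightarrow> 'n) \<Rightarrow> bool" where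
  "cp_bihom R M A N B D \<longleftrightarrow>
     (\<forall>m\<in>carrier M. \<forall>n\<in>carrier M. D m n \<in> B) \<and>
     (\<forall>m\<in>carrier M. \<forall>m'\<in>carrier M. \<forall>n\<in>carrier M.
        D (m \<oplus>\<^bsub>M\<^esub> m') n = D m n \<oplus>\<^bsub>N\<^esub> D m' n \<and> D n (m \<oplus>\<^bsub>M\<^esub> m') = D n m \<oplus>\<^bsub>N\<^esub> D n m') \<and>
     (\<forall>m\<in>carrier M. \<forall>n\<in>carrier M. \<forall>r\<in>carrier R.
        D (mact M m r) n = mact N (D m n) r \<and> D n (mact M m r) = mact N (D n m) r) \<and>
     (\<forall>m\<in>carrier M. \<forall>a\<in>A. D m a = \<zero>\<^bsub>N\<^esub> \<and> D a m = \<zero>\<^bsub>N\<^esub>)"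

definition cp_hom2 ::
  "('r, 'x, 'e) sqring_scheme \<Rightarrow> ('m, 'r, 'x, 'f) bhp_scheme \<Rightarrow> 'm set
    \<Rightarrow> ('n, 'r, 'x, 'g) bhp_scheme \<Rightarrow> 'n set \<Rightarrow> ('m \<Rightarrow> 'n) \<Rightarrow> bool" where
  "cp_hom2 R M A N B E \<longleftrightarrow>
     (\<forall>m\<in>carrier M. E m \<in> B) \<and>
     (\<forall>m\<in>carrier M. \<forall>s\<in>carrier R. E (mact M m s) = mact N (E m) (s \<otimes>\<^bsub>R\<^esub> s)) \<and>
     (\<forall>a\<in>A. E a = \<zero>\<^bsub>N\<^esub>)"

text \<open>
  Equivalent to \<^const>\<open>cp_quadratic\<close>. Giving the deviations as error terms avoids subtraction in the
  non-commutative groups.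
\<close>

definition cp_quad ::
  "('r, 'x, 'e) sqring_scheme \<Rightarrow> ('m, 'r, 'x, 'f) bhp_scheme \<Rightarrow> 'm set
    \<Rightarrow> ('n, 'r, 'x, 'g) bhp_scheme \<Rightarrow> 'n set \<Rightarrow> ('m \<Rightarrow> 'n) \<Rightarrow> bool" where
  "cp_quad R M A N B f \<longleftrightarrow>
     f \<in> carrier M \<rightarrow> carrier N \<and> f ` A \<subseteq> B \<and>
     (\<exists>D. cp_bihom R M A N B D \<and>
        (\<forall>m\<in>carrier M. \<forall>m'\<in>carrier M. f (m \<oplus>\<^bsub>M\<^esub> m') = f m \<oplus>\<^bsub>N\<^esub> f m' \<oplus>\<^bsub>N\<^esub> D m m')) \<and>
     (\<forall>r\<in>carrier R. \<exists>E. cp_hom2 R M A N B E \<and>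
        (\<forall>m\<in>carrier M. f (mact M m r) = mact N (f m) r \<oplus>\<^bsub>N\<^esub> E m)) \<and>
     (\<forall>x\<in>carrier (ee R). \<exists>D. cp_bihom R M A N B D \<and>
        (\<forall>m\<in>carrier M. \<forall>m'\<in>carrier M.
          f (mbr M m m' x) = mbr N (f m) (f m') x \<oplus>\<^bsub>N\<^esub> D m m'))"

lemma cp_bihom_cong:
  assumes "cp_mod R M A"
    and "\<And>m n. \<lbrakk>m \<in> carrier M; n \<in> carrier M\<rbrakk> \<Longrightarrow> D m n = D' m n"
  shows "cp_bihom R M A N B D \<longleftrightarrow> cp_bihom R M A N B D'"
proof -
  interpret cp_mod R M A by fact
  show ?thesis unfolding cp_bihom_def using assms(2) by simp
qed

lemma cp_hom2_cong:
  assumes "cp_mod R M A"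
    and "\<And>m. m \<in> carrier M \<Longrightarrow> E m = E' m"
  shows "cp_hom2 R M A N B E \<longleftrightarrow> cp_hom2 R M A N B E'"
proof -
  interpret cp_mod R M A by fact
  show ?thesis unfolding cp_hom2_def using assms(2) by simp
qed

context cp_mod
begin

lemma A_stable:
  "additive_subgroup A M \<and> (\<forall>u\<in>A. \<forall>r\<in>carrier R. mact M u r \<in> A) \<and>
   (\<forall>u\<in>A. \<forall>v\<in>A. \<forall>x\<in>carrier (ee R). mbr M u v x \<in> A)"
  using A_subgroup by (simp add: additive_subgroup_def)

lemma span_subset_A: "sq_span R M S \<subseteq> A \<longleftrightarrow> S \<subseteq> A"
proof
  show "sq_span R M S \<subseteq> A \<Longrightarrow> S \<subseteq> A" unfolding sq_span_def by blast
  show "S \<subseteq> A \<Longrightarrow> sq_span R M S \<subseteq> A"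
    unfolding sq_span_def using A_stable by (intro Inter_lower) blast
qed

lemma minus_add_cancel:
  "\<lbrakk>m \<in> carrier M; n \<in> carrier M\<rbrakk> \<Longrightarrow> \<ominus>\<^bsub>M\<^esub> m \<oplus>\<^bsub>M\<^esub> (m \<oplus>\<^bsub>M\<^esub> n) = n"
  by (simp flip: add.m_assoc)

lemma eq_add_dev:
  assumes "m \<in> carrier M" "n \<in> carrier M" "k \<in> carrier M"
  shows "k \<ominus>\<^bsub>M\<^esub> n \<ominus>\<^bsub>M\<^esub> m \<in> A \<Longrightarrow> k = m \<oplus>\<^bsub>M\<^esub> n \<oplus>\<^bsub>M\<^esub> (k \<ominus>\<^bsub>M\<^esub> n \<ominus>\<^bsub>M\<^esub> m)"
    "a \<in> A \<Longrightarrow> k = m \<oplus>\<^bsub>M\<^esub> n \<oplus>\<^bsub>M\<^esub> a \<Longrightarrow> k \<ominus>\<^bsub>M\<^esub> n \<ominus>\<^bsub>M\<^esub> m = a"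
proof -
  assume a: "k \<ominus>\<^bsub>M\<^esub> n \<ominus>\<^bsub>M\<^esub> m \<in> A"
  have "k = (k \<ominus>\<^bsub>M\<^esub> n \<ominus>\<^bsub>M\<^esub> m) \<oplus>\<^bsub>M\<^esub> (m \<oplus>\<^bsub>M\<^esub> n)"
    using assms by (simp add: a_minus_def add.m_assoc minus_add_cancel)
  then show "k = m \<oplus>\<^bsub>M\<^esub> n \<oplus>\<^bsub>M\<^esub> (k \<ominus>\<^bsub>M\<^esub> n \<ominus>\<^bsub>M\<^esub> m)"
    using A_central[OF a, of "m \<oplus>\<^bsub>M\<^esub> n"] assms by simp
next
  assume "a \<in> A" "k = m \<oplus>\<^bsub>M\<^esub> n \<oplus>\<^bsub>M\<^esub> a"
  then have "k = a \<oplus>\<^bsub>M\<^esub> (m \<oplus>\<^bsub>M\<^esub> n)"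
    using A_central[of a "m \<oplus>\<^bsub>M\<^esub> n"] assms by simp
  then show "k \<ominus>\<^bsub>M\<^esub> n \<ominus>\<^bsub>M\<^esub> m = a"
    using \<open>a \<in> A\<close> assms by (simp add: a_minus_def add.m_assoc)
qed

lemma eq_add_minus:
  assumes "m \<in> carrier M" "k \<in> carrier M"
  shows "k \<ominus>\<^bsub>M\<^esub> m \<in> A \<Longrightarrow> k = m \<oplus>\<^bsub>M\<^esub> (k \<ominus>\<^bsub>M\<^esub> m)"
    "a \<in> A \<Longrightarrow> k = m \<oplus>\<^bsub>M\<^esub> a \<Longrightarrow> k \<ominus>\<^bsub>M\<^esub> m = a"
proof -
  assume a: "k \<ominus>\<^bsub>M\<^esub> m \<in> A"
  have "k = (k \<ominus>\<^bsub>M\<^esub> m) \<oplus>\<^bsub>M\<^esub> m"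
    using assms by (simp add: a_minus_def add.m_assoc)
  then show "k = m \<oplus>\<^bsub>M\<^esub> (k \<ominus>\<^bsub>M\<^esub> m)"
    using A_central[OF a, of m] assms by simp
next
  assume "a \<in> A" "k = m \<oplus>\<^bsub>M\<^esub> a"
  then show "k \<ominus>\<^bsub>M\<^esub> m = a"
    using A_central[of a m] assms by (simp add: a_minus_def add.m_assoc)
qed

end

locale cp_mod_pair = M: cp_mod R M A + N: cp_mod R N B
  for R :: "('r, 'x, 'e) sqring_scheme" (structure)
    and M :: "('m, 'r, 'x, 'f) bhp_scheme" and A :: "'m set"
    and N :: "('n, 'r, 'x, 'g) bhp_scheme" and B :: "'n set"
begin

lemma bilinear_iff_bihom:
  assumes "\<And>m n. \<lbrakk>m \<in> carrier M; n \<in> carrier M\<rbrakk> \<Longrightarrow> D m n \<in> B"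
    and "\<And>m a. \<lbrakk>m \<in> carrier M; a \<in> A\<rbrakk> \<Longrightarrow> D m a = \<zero>\<^bsub>N\<^esub> \<and> D a m = \<zero>\<^bsub>N\<^esub>"
  shows "sq_bilinear R M N D \<longleftrightarrow> cp_bihom R M A N B D"
  unfolding sq_bilinear_def sq_linear_def cp_bihom_def hom_def
  using assms by (auto simp: Pi_iff)

lemma cp_quadD:
  assumes "cp_quad R M A N B f"
  shows "f \<in> carrier M \<rightarrow> carrier N" "f ` A \<subseteq> B"
    "cp_bihom R M A N B (dev M N f)"
    "\<lbrakk>m \<in> carrier M; n \<in> carrier M\<rbrakk> \<Longrightarrow> f (m \<oplus>\<^bsub>M\<^esub> n) = f m \<oplus>\<^bsub>N\<^esub> f n \<oplus>\<^bsub>N\<^esub> dev M N f m n"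
    "r \<in> carrier R \<Longrightarrow> cp_hom2 R M A N B (dev_act M N f r)"
    "\<lbrakk>m \<in> carrier M; r \<in> carrier R\<rbrakk>
      \<Longrightarrow> f (mact M m r) = mact N (f m) r \<oplus>\<^bsub>N\<^esub> dev_act M N f r m"
    "x \<in> carrier (ee R) \<Longrightarrow> cp_bihom R M A N B (dev_br M N f x)"
    "\<lbrakk>m \<in> carrier M; n \<in> carrier M; x \<in> carrier (ee R)\<rbrakk>
      \<Longrightarrow> f (mbr M m n x) = mbr N (f m) (f n) x \<oplus>\<^bsub>N\<^esub> dev_br M N f x m n"
proof -
  show f: "f \<in> carrier M \<rightarrow> carrier N" and "f ` A \<subseteq> B"
    using assms by (auto simp: cp_quad_def)
  obtain D where D: "cp_bihom R M A N B D" "\<And>m n. \<lbrakk>m \<in> carrier M; n \<in> carrier M\<rbrakk>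
      \<Longrightarrow> f (m \<oplus>\<^bsub>M\<^esub> n) = f m \<oplus>\<^bsub>N\<^esub> f n \<oplus>\<^bsub>N\<^esub> D m n"
    using assms by (auto simp: cp_quad_def)
  have DB: "D m n \<in> B" if "m \<in> carrier M" "n \<in> carrier M" for m n
    using D that by (auto simp: cp_bihom_def)
  have *: "dev M N f m n = D m n" if "m \<in> carrier M" "n \<in> carrier M" for m n
    using N.eq_add_dev(2)[of "f m" "f n" "f (m \<oplus>\<^bsub>M\<^esub> n)" "D m n"] D f DB that
    unfolding dev_def by (auto simp: Pi_iff)
  show "cp_bihom R M A N B (dev M N f)"
    using D * cp_bihom_cong[OF M.cp_mod_axioms, of "dev M N f" D] by blast
  show "\<lbrakk>m \<in> carrier M; n \<in> carrier M\<rbrakk> \<Longrightarrow> f (m \<oplus>\<^bsub>M\<^esub> n) = f m \<oplus>\<^bsub>N\<^esub> f n \<oplus>\<^bsub>N\<^esub> dev M N f m n"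
    using D * by simp
  have "cp_hom2 R M A N B (dev_act M N f r) \<and>
    (\<forall>m\<in>carrier M. f (mact M m r) = mact N (f m) r \<oplus>\<^bsub>N\<^esub> dev_act M N f r m)"
    if r: "r \<in> carrier R" for r
  proof -
    obtain E where E: "cp_hom2 R M A N B E" "\<And>m. m \<in> carrier M
        \<Longrightarrow> f (mact M m r) = mact N (f m) r \<oplus>\<^bsub>N\<^esub> E m"
      using assms r by (auto simp: cp_quad_def)
    have EB: "E m \<in> B" if "m \<in> carrier M" for m
      using E that by (auto simp: cp_hom2_def)
    have *: "dev_act M N f r m = E m" if "m \<in> carrier M" for m
      using N.eq_add_minus(2)[of "mact N (f m) r" "f (mact M m r)" "E m"] E f EB that r
      unfolding dev_act_def by (auto simp: Pi_iff)
    show ?thesis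
      using E * cp_hom2_cong[OF M.cp_mod_axioms, of "dev_act M N f r" E N B] by simp
  qed
  then show "r \<in> carrier R \<Longrightarrow> cp_hom2 R M A N B (dev_act M N f r)"
    and "\<lbrakk>m \<in> carrier M; r \<in> carrier R\<rbrakk>
      \<Longrightarrow> f (mact M m r) = mact N (f m) r \<oplus>\<^bsub>N\<^esub> dev_act M N f r m"
    by blast+
  have "cp_bihom R M A N B (dev_br M N f x) \<and> (\<forall>m\<in>carrier M. \<forall>n\<in>carrier M.
      f (mbr M m n x) = mbr N (f m) (f n) x \<oplus>\<^bsub>N\<^esub> dev_br M N f x m n)"
    if x: "x \<in> carrier (ee R)" for x
  proof -
    obtain D where D: "cp_bihom R M A N B D" "\<And>m n. \<lbrakk>m \<in> carrier M; n \<in> carrier M\<rbrakk>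
        \<Longrightarrow> f (mbr M m n x) = mbr N (f m) (f n) x \<oplus>\<^bsub>N\<^esub> D m n"
      using assms x by (auto simp: cp_quad_def)
    have DB: "D m n \<in> B" if "m \<in> carrier M" "n \<in> carrier M" for m n
      using D that by (auto simp: cp_bihom_def)
    have *: "dev_br M N f x m n = D m n" if "m \<in> carrier M" "n \<in> carrier M" for m n
      using N.eq_add_minus(2)[of "mbr N (f m) (f n) x" "f (mbr M m n x)" "D m n"]
        D f DB that x
      unfolding dev_br_def by (auto simp: Pi_iff)
    show ?thesis
      using D * cp_bihom_cong[OF M.cp_mod_axioms, of "dev_br M N f x" D N B] by simp
  qed
  then show "x \<in> carrier (ee R) \<Longrightarrow> cp_bihom R M A N B (dev_br M N f x)"
    and "\<lbrakk>m \<in> carrier M; n \<in> carrier M; x \<in> carrier (ee R)\<rbrakk>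
      \<Longrightarrow> f (mbr M m n x) = mbr N (f m) (f n) x \<oplus>\<^bsub>N\<^esub> dev_br M N f x m n"
    by blast+
qed

lemma cp_quadratic_iff_quad: "cp_quadratic R (M, A) (N, B) f \<longleftrightarrow> cp_quad R M A N B f"
proof
  assume q: "cp_quad R M A N B f"
  note f = cp_quadD[OF q]
  have B: "dev M N f m n \<in> B" "\<And>r. r \<in> carrier R \<Longrightarrow> dev_act M N f r m \<in> B"
    "\<And>x. x \<in> carrier (ee R) \<Longrightarrow> dev_br M N f x m n \<in> B"
    if "m \<in> carrier M" "n \<in> carrier M" for m n
    using f(3,5,7) that by (auto simp: cp_bihom_def cp_hom2_def)
  have 0: "dev M N f m a = \<zero>\<^bsub>N\<^esub> \<and> dev M N f a m = \<zero>\<^bsub>N\<^esub>"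
    "\<And>r. r \<in> carrier R \<Longrightarrow> dev_act M N f r a = \<zero>\<^bsub>N\<^esub>"
    "\<And>x. x \<in> carrier (ee R) \<Longrightarrow> dev_br M N f x m a = \<zero>\<^bsub>N\<^esub> \<and> dev_br M N f x a m = \<zero>\<^bsub>N\<^esub>"
    if "m \<in> carrier M" "a \<in> A" for m a
    using f(3,5,7) that by (auto simp: cp_bihom_def cp_hom2_def)
  have "sq_bilinear R M N (dev M N f)"
    "\<And>x. x \<in> carrier (ee R) \<Longrightarrow> sq_bilinear R M N (dev_br M N f x)"
    using bilinear_iff_bihom B 0 f(3,7) by metis+
  then show "cp_quadratic R (M, A) (N, B) f"
    unfolding cp_quadratic.simps N.span_subset_A
    using M.cp N.cp f(1,2,5) B 0 by (auto simp: cp_hom2_def)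
next
  assume "cp_quadratic R (M, A) (N, B) f"
  then have q: "f \<in> carrier M \<rightarrow> carrier N" "f ` A \<subseteq> B"
    "\<And>m n. \<lbrakk>m \<in> carrier M; n \<in> carrier M\<rbrakk> \<Longrightarrow> dev M N f m n \<in> B"
    "\<And>r m. \<lbrakk>r \<in> carrier R; m \<in> carrier M\<rbrakk> \<Longrightarrow> dev_act M N f r m \<in> B"
    "\<And>x m n. \<lbrakk>x \<in> carrier (ee R); m \<in> carrier M; n \<in> carrier M\<rbrakk> \<Longrightarrow> dev_br M N f x m n \<in> B"
    "sq_bilinear R M N (dev M N f)"
    "\<And>x. x \<in> carrier (ee R) \<Longrightarrow> sq_bilinear R M N (dev_br M N f x)"
    "\<And>m r s. \<lbrakk>m \<in> carrier M; r \<in> carrier R; s \<in> carrier R\<rbrakk>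
      \<Longrightarrow> dev_act M N f r (mact M m s) = mact N (dev_act M N f r m) (s \<otimes> s)"
    "\<And>m a. \<lbrakk>m \<in> carrier M; a \<in> A\<rbrakk> \<Longrightarrow> dev M N f m a = \<zero>\<^bsub>N\<^esub> \<and> dev M N f a m = \<zero>\<^bsub>N\<^esub>"
    "\<And>r a. \<lbrakk>r \<in> carrier R; a \<in> A\<rbrakk> \<Longrightarrow> dev_act M N f r a = \<zero>\<^bsub>N\<^esub>"
    "\<And>x m a. \<lbrakk>x \<in> carrier (ee R); m \<in> carrier M; a \<in> A\<rbrakk>
      \<Longrightarrow> dev_br M N f x m a = \<zero>\<^bsub>N\<^esub> \<and> dev_br M N f x a m = \<zero>\<^bsub>N\<^esub>"
    unfolding cp_quadratic.simps N.span_subset_A by (auto simp: image_subset_iff)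
  have "cp_bihom R M A N B (dev M N f)"
    using bilinear_iff_bihom q(3,6,9) by blast
  moreover have "\<And>x. x \<in> carrier (ee R) \<Longrightarrow> cp_bihom R M A N B (dev_br M N f x)"
    using bilinear_iff_bihom q(5,7,11) by blast
  moreover have "\<And>r. r \<in> carrier R \<Longrightarrow> cp_hom2 R M A N B (dev_act M N f r)"
    using q(4,8,10) by (auto simp: cp_hom2_def)
  moreover have "f (m \<oplus>\<^bsub>M\<^esub> n) = f m \<oplus>\<^bsub>N\<^esub> f n \<oplus>\<^bsub>N\<^esub> dev M N f m n"
    if "m \<in> carrier M" "n \<in> carrier M" for m n
    using N.eq_add_dev(1)[of "f m" "f n" "f (m \<oplus>\<^bsub>M\<^esub> n)"] q(1,3) that
    unfolding dev_def by (auto simp: Pi_iff)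
  moreover have "f (mact M m r) = mact N (f m) r \<oplus>\<^bsub>N\<^esub> dev_act M N f r m"
    if "m \<in> carrier M" "r \<in> carrier R" for m r
    using N.eq_add_minus(1)[of "mact N (f m) r" "f (mact M m r)"] q(1,4) that
    unfolding dev_act_def by (auto simp: Pi_iff)
  moreover have "f (mbr M m n x) = mbr N (f m) (f n) x \<oplus>\<^bsub>N\<^esub> dev_br M N f x m n"
    if "m \<in> carrier M" "n \<in> carrier M" "x \<in> carrier (ee R)" for m n x
    using N.eq_add_minus(1)[of "mbr N (f m) (f n) x" "f (mbr M m n x)"] q(1,5) that
    unfolding dev_br_def by (auto simp: Pi_iff)
  ultimately show "cp_quad R M A N B f"
    unfolding cp_quad_def using q(1,2) by metis
qed

end

context cp_mod
begin

lemma add_add_swap: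
  assumes "p \<in> carrier M" "q \<in> carrier M" "u \<in> carrier M" "v \<in> carrier M" "a \<in> A" "b \<in> A"
  shows "p \<oplus>\<^bsub>M\<^esub> q \<oplus>\<^bsub>M\<^esub> a \<oplus>\<^bsub>M\<^esub> (u \<oplus>\<^bsub>M\<^esub> v \<oplus>\<^bsub>M\<^esub> b)
    = p \<oplus>\<^bsub>M\<^esub> u \<oplus>\<^bsub>M\<^esub> (q \<oplus>\<^bsub>M\<^esub> v) \<oplus>\<^bsub>M\<^esub> (mbr M u q (sqH R (\<one> \<oplus> \<one>)) \<oplus>\<^bsub>M\<^esub> a \<oplus>\<^bsub>M\<^esub> b)"
proof -
  let ?c = "mbr M u q (sqH R (\<one> \<oplus> \<one>))"
  have "p \<oplus>\<^bsub>M\<^esub> q \<oplus>\<^bsub>M\<^esub> a \<oplus>\<^bsub>M\<^esub> (u \<oplus>\<^bsub>M\<^esub> v \<oplus>\<^bsub>M\<^esub> b) = p \<oplus>\<^bsub>M\<^esub> q \<oplus>\<^bsub>M\<^esub> (a \<oplus>\<^bsub>M\<^esub> (u \<oplus>\<^bsub>M\<^esub> v)) \<oplus>\<^bsub>M\<^esub> b"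
    using assms by (simp add: add.m_assoc)
  also have "a \<oplus>\<^bsub>M\<^esub> (u \<oplus>\<^bsub>M\<^esub> v) = u \<oplus>\<^bsub>M\<^esub> v \<oplus>\<^bsub>M\<^esub> a"
    using assms A_central[of a "u \<oplus>\<^bsub>M\<^esub> v"] by simp
  also have "p \<oplus>\<^bsub>M\<^esub> q \<oplus>\<^bsub>M\<^esub> (u \<oplus>\<^bsub>M\<^esub> v \<oplus>\<^bsub>M\<^esub> a) \<oplus>\<^bsub>M\<^esub> b = p \<oplus>\<^bsub>M\<^esub> (q \<oplus>\<^bsub>M\<^esub> u) \<oplus>\<^bsub>M\<^esub> v \<oplus>\<^bsub>M\<^esub> a \<oplus>\<^bsub>M\<^esub> b"
    using assms by (simp add: add.m_assoc)
  also have "q \<oplus>\<^bsub>M\<^esub> u = u \<oplus>\<^bsub>M\<^esub> q \<oplus>\<^bsub>M\<^esub> ?c"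
    using assms commute_br by blast
  also have "p \<oplus>\<^bsub>M\<^esub> (u \<oplus>\<^bsub>M\<^esub> q \<oplus>\<^bsub>M\<^esub> ?c) \<oplus>\<^bsub>M\<^esub> v \<oplus>\<^bsub>M\<^esub> a \<oplus>\<^bsub>M\<^esub> b = p \<oplus>\<^bsub>M\<^esub> u \<oplus>\<^bsub>M\<^esub> q \<oplus>\<^bsub>M\<^esub> (?c \<oplus>\<^bsub>M\<^esub> v) \<oplus>\<^bsub>M\<^esub> a \<oplus>\<^bsub>M\<^esub> b"
    using assms by (simp add: add.m_assoc)
  also have "?c \<oplus>\<^bsub>M\<^esub> v = v \<oplus>\<^bsub>M\<^esub> ?c"
    using assms A_central[of ?c v] by simp
  finally show ?thesis using assms by (simp add: add.m_assoc)
qed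

lemma add_add_A:
  assumes "p \<in> carrier M" "q \<in> carrier M" "a \<in> A" "b \<in> A"
  shows "p \<oplus>\<^bsub>M\<^esub> a \<oplus>\<^bsub>M\<^esub> (q \<oplus>\<^bsub>M\<^esub> b) = p \<oplus>\<^bsub>M\<^esub> q \<oplus>\<^bsub>M\<^esub> (a \<oplus>\<^bsub>M\<^esub> b)"
  using assms by (simp add: add.m_assoc A_left_central[of a q b])

lemma A_minus_cancel [simp]:
  "\<lbrakk>a \<in> A; m \<in> carrier M\<rbrakk> \<Longrightarrow> a \<oplus>\<^bsub>M\<^esub> (\<ominus>\<^bsub>M\<^esub> a \<oplus>\<^bsub>M\<^esub> m) = m"
  by (simp flip: add.m_assoc)

end

context cp_mod_pair
begin

lemma bihom_add:
  assumes "cp_bihom R M A N B D" "cp_bihom R M A N B D'"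
  shows "cp_bihom R M A N B (\<lambda>m n. D m n \<oplus>\<^bsub>N\<^esub> D' m n)"
  using assms unfolding cp_bihom_def by (simp add: N.A_ac N.add_act_A)

lemma bihom_act:
  assumes "cp_bihom R M A N B D" "r \<in> carrier R"
  shows "cp_bihom R M A N B (\<lambda>m n. mact N (D m n) r)"
  using assms unfolding cp_bihom_def by (simp add: N.add_act_A N.A_act_commute[of _ r])

lemma bihom_zero: "cp_bihom R M A N B (\<lambda>m n. \<zero>\<^bsub>N\<^esub>)"
  unfolding cp_bihom_def by simp

lemma bihom_minus:
  assumes "cp_bihom R M A N B D"
  shows "cp_bihom R M A N B (\<lambda>m n. \<ominus>\<^bsub>N\<^esub> D m n)"
proof -
  have "mact N (D m n) (\<ominus> \<one>) = \<ominus>\<^bsub>N\<^esub> D m n" if "m \<in> carrier M" "n \<in> carrier M" for m n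
    using assms that by (simp add: cp_bihom_def N.act_minus_one)
  then show ?thesis
    using bihom_act[OF assms, of "\<ominus> \<one>"] M.R_minus_closed
      cp_bihom_cong[OF M.cp_mod_axioms, of "\<lambda>m n. mact N (D m n) (\<ominus> \<one>)" "\<lambda>m n. \<ominus>\<^bsub>N\<^esub> D m n" N B]
    by simp
qed

lemma bihom_flip: "cp_bihom R M A N B D \<Longrightarrow> cp_bihom R M A N B (\<lambda>m n. D n m)"
  unfolding cp_bihom_def by blast

lemma hom2_add:
  assumes "cp_hom2 R M A N B E" "cp_hom2 R M A N B E'"
  shows "cp_hom2 R M A N B (\<lambda>m. E m \<oplus>\<^bsub>N\<^esub> E' m)"
  using assms unfolding cp_hom2_def by (simp add: N.add_act_A)

lemma hom2_act:
  assumes "cp_hom2 R M A N B E" "r \<in> carrier R"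
  shows "cp_hom2 R M A N B (\<lambda>m. mact N (E m) r)"
  using assms unfolding cp_hom2_def by (simp add: N.A_act_commute[of _ r])

lemma bihom_diag:
  assumes "cp_bihom R M A N B D"
  shows "cp_hom2 R M A N B (\<lambda>m. D m m)"
  using assms unfolding cp_bihom_def cp_hom2_def by (simp add: N.mact_mult)

lemma quad_value [simp]:
  assumes "cp_quad R M A N B f"
  shows "m \<in> carrier M \<Longrightarrow> f m \<in> carrier N" "a \<in> A \<Longrightarrow> f a \<in> B"
  using cp_quadD(1,2)[OF assms] by auto

lemma quad_dev_B [simp]:
  assumes "cp_quad R M A N B f"
  shows "\<lbrakk>m \<in> carrier M; n \<in> carrier M\<rbrakk> \<Longrightarrow> dev M N f m n \<in> B"
    "\<lbrakk>m \<in> carrier M; r \<in> carrier R\<rbrakk> \<Longrightarrow> dev_act M N f r m \<in> B"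
    "\<lbrakk>m \<in> carrier M; n \<in> carrier M; x \<in> carrier (ee R)\<rbrakk> \<Longrightarrow> dev_br M N f x m n \<in> B"
  using cp_quadD(3,5,7)[OF assms] by (auto simp: cp_bihom_def cp_hom2_def)

lemma bihom_br:
  assumes "cp_quad R M A N B f" "cp_quad R M A N B g" "x \<in> carrier (ee R)"
  shows "cp_bihom R M A N B (\<lambda>m n. mbr N (f m) (g n) x)"
  using assms unfolding cp_bihom_def
  by (simp add: cp_quadD(4,6) N.mbr_add1 N.mbr_add2 N.br_act1 N.br_act2)

lemma quadI:
  assumes "\<And>m. m \<in> carrier M \<Longrightarrow> f m \<in> carrier N" "\<And>a. a \<in> A \<Longrightarrow> f a \<in> B"
    and "cp_bihom R M A N B D"
      "\<And>m m'. \<lbrakk>m \<in> carrier M; m' \<in> carrier M\<rbrakk> \<Longrightarrow> f (m \<oplus>\<^bsub>M\<^esub> m') = f m \<oplus>\<^bsub>N\<^esub> f m' \<oplus>\<^bsub>N\<^esub> D m m'"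
    and "\<And>r. r \<in> carrier R \<Longrightarrow> cp_hom2 R M A N B (E r)"
      "\<And>r m. \<lbrakk>r \<in> carrier R; m \<in> carrier M\<rbrakk> \<Longrightarrow> f (mact M m r) = mact N (f m) r \<oplus>\<^bsub>N\<^esub> E r m"
    and "\<And>x. x \<in> carrier (ee R) \<Longrightarrow> cp_bihom R M A N B (F x)"
      "\<And>x m m'. \<lbrakk>x \<in> carrier (ee R); m \<in> carrier M; m' \<in> carrier M\<rbrakk>
        \<Longrightarrow> f (mbr M m m' x) = mbr N (f m) (f m') x \<oplus>\<^bsub>N\<^esub> F x m m'"
  shows "cp_quad R M A N B f"
proof -
  have 1: "f \<in> carrier M \<rightarrow> carrier N" "f ` A \<subseteq> B" using assms(1,2) by auto
  have 2: "\<exists>D. cp_bihom R M A N B D \<and>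
      (\<forall>m\<in>carrier M. \<forall>m'\<in>carrier M. f (m \<oplus>\<^bsub>M\<^esub> m') = f m \<oplus>\<^bsub>N\<^esub> f m' \<oplus>\<^bsub>N\<^esub> D m m')"
    using assms(3,4) by (intro exI[of _ D]) simp
  have 3: "\<exists>E. cp_hom2 R M A N B E \<and>
      (\<forall>m\<in>carrier M. f (mact M m r) = mact N (f m) r \<oplus>\<^bsub>N\<^esub> E m)"
    if "r \<in> carrier R" for r
    using assms(5,6) that by (intro exI[of _ "E r"]) simp
  have 4: "\<exists>D. cp_bihom R M A N B D \<and>
      (\<forall>m\<in>carrier M. \<forall>m'\<in>carrier M. f (mbr M m m' x) = mbr N (f m) (f m') x \<oplus>\<^bsub>N\<^esub> D m m')"
    if "x \<in> carrier (ee R)" for x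
    using assms(7,8) that by (intro exI[of _ "F x"]) simp
  show ?thesis unfolding cp_quad_def by (intro conjI ballI 1 2 3 4)
qed

lemma quad_cong:
  assumes "\<And>m. m \<in> carrier M \<Longrightarrow> f m = g m"
  shows "cp_quad R M A N B f \<longleftrightarrow> cp_quad R M A N B g"
proof -
  have "f \<in> carrier M \<rightarrow> carrier N \<longleftrightarrow> g \<in> carrier M \<rightarrow> carrier N" "f ` A \<subseteq> B \<longleftrightarrow> g ` A \<subseteq> B"
    using assms by (auto simp: Pi_iff image_subset_iff)
  then show ?thesis unfolding cp_quad_def using assms by simp
qed

lemma quad_zero: "cp_quad R M A N B (\<lambda>m. \<zero>\<^bsub>N\<^esub>)"
  by (rule quadI[where D = "\<lambda>m n. \<zero>\<^bsub>N\<^esub>" and E = "\<lambda>r m. \<zero>\<^bsub>N\<^esub>" and F = "\<lambda>x m n. \<zero>\<^bsub>N\<^esub>"])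
    (simp_all add: bihom_zero cp_hom2_def)

lemma quad_add:
  assumes f: "cp_quad R M A N B f" and g: "cp_quad R M A N B g"
  shows "cp_quad R M A N B (\<lambda>m. f m \<oplus>\<^bsub>N\<^esub> g m)"
proof (rule quadI[where
      D = "\<lambda>m n. mbr N (g m) (f n) (sqH R (\<one> \<oplus> \<one>)) \<oplus>\<^bsub>N\<^esub> dev M N f m n \<oplus>\<^bsub>N\<^esub> dev M N g m n"
      and E = "\<lambda>r m. \<ominus>\<^bsub>N\<^esub> mbr N (f m) (g m) (sqH R r) \<oplus>\<^bsub>N\<^esub> (dev_act M N f r m \<oplus>\<^bsub>N\<^esub> dev_act M N g r m)"
      and F = "\<lambda>x m n. \<ominus>\<^bsub>N\<^esub> mbr N (f m) (g n) x \<oplus>\<^bsub>N\<^esub> (\<ominus>\<^bsub>N\<^esub> mbr N (g m) (f n) x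
        \<oplus>\<^bsub>N\<^esub> (dev_br M N f x m n \<oplus>\<^bsub>N\<^esub> dev_br M N g x m n))"])
  show "cp_bihom R M A N B
      (\<lambda>m n. mbr N (g m) (f n) (sqH R (\<one> \<oplus> \<one>)) \<oplus>\<^bsub>N\<^esub> dev M N f m n \<oplus>\<^bsub>N\<^esub> dev M N g m n)"
    by (intro bihom_add bihom_br cp_quadD(3) f g) simp
  show "cp_hom2 R M A N B (\<lambda>m. \<ominus>\<^bsub>N\<^esub> mbr N (f m) (g m) (sqH R r)
      \<oplus>\<^bsub>N\<^esub> (dev_act M N f r m \<oplus>\<^bsub>N\<^esub> dev_act M N g r m))" if "r \<in> carrier R" for r
    using that bihom_diag[OF bihom_minus[OF bihom_br[OF f g, of "sqH R r"]]]
    by (intro hom2_add cp_quadD(5) f g) simp_all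
  show "cp_bihom R M A N B (\<lambda>m n. \<ominus>\<^bsub>N\<^esub> mbr N (f m) (g n) x \<oplus>\<^bsub>N\<^esub> (\<ominus>\<^bsub>N\<^esub> mbr N (g m) (f n) x
        \<oplus>\<^bsub>N\<^esub> (dev_br M N f x m n \<oplus>\<^bsub>N\<^esub> dev_br M N g x m n)))" if "x \<in> carrier (ee R)" for x
    using that by (intro bihom_add bihom_minus bihom_br cp_quadD(7) f g)
  show "f (m \<oplus>\<^bsub>M\<^esub> n) \<oplus>\<^bsub>N\<^esub> g (m \<oplus>\<^bsub>M\<^esub> n) = f m \<oplus>\<^bsub>N\<^esub> g m \<oplus>\<^bsub>N\<^esub> (f n \<oplus>\<^bsub>N\<^esub> g n)
      \<oplus>\<^bsub>N\<^esub> (mbr N (g m) (f n) (sqH R (\<one> \<oplus> \<one>)) \<oplus>\<^bsub>N\<^esub> dev M N f m n \<oplus>\<^bsub>N\<^esub> dev M N g m n)"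
    if "m \<in> carrier M" "n \<in> carrier M" for m n
    using that f g by (simp add: cp_quadD(4) N.add_add_swap)
  show "f (mact M m r) \<oplus>\<^bsub>N\<^esub> g (mact M m r) = mact N (f m \<oplus>\<^bsub>N\<^esub> g m) r
      \<oplus>\<^bsub>N\<^esub> (\<ominus>\<^bsub>N\<^esub> mbr N (f m) (g m) (sqH R r) \<oplus>\<^bsub>N\<^esub> (dev_act M N f r m \<oplus>\<^bsub>N\<^esub> dev_act M N g r m))"
    if "r \<in> carrier R" "m \<in> carrier M" for r m
  proof -
    have "f (mact M m r) \<oplus>\<^bsub>N\<^esub> g (mact M m r)
        = mact N (f m) r \<oplus>\<^bsub>N\<^esub> mact N (g m) r \<oplus>\<^bsub>N\<^esub> (dev_act M N f r m \<oplus>\<^bsub>N\<^esub> dev_act M N g r m)"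
      using that f g by (simp add: cp_quadD(6) N.add_add_A)
    then show ?thesis using that f g by (simp add: N.add_mact N.add.m_assoc)
  qed
  show "f (mbr M m n x) \<oplus>\<^bsub>N\<^esub> g (mbr M m n x) = mbr N (f m \<oplus>\<^bsub>N\<^esub> g m) (f n \<oplus>\<^bsub>N\<^esub> g n) x
      \<oplus>\<^bsub>N\<^esub> (\<ominus>\<^bsub>N\<^esub> mbr N (f m) (g n) x \<oplus>\<^bsub>N\<^esub> (\<ominus>\<^bsub>N\<^esub> mbr N (g m) (f n) x
        \<oplus>\<^bsub>N\<^esub> (dev_br M N f x m n \<oplus>\<^bsub>N\<^esub> dev_br M N g x m n)))"
    if "x \<in> carrier (ee R)" "m \<in> carrier M" "n \<in> carrier M" for x m n
  proof -
    have *: "f (mbr M m n x) \<oplus>\<^bsub>N\<^esub> g (mbr M m n x) = mbr N (f m) (f n) x \<oplus>\<^bsub>N\<^esub> mbr N (g m) (g n) x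
        \<oplus>\<^bsub>N\<^esub> (dev_br M N f x m n \<oplus>\<^bsub>N\<^esub> dev_br M N g x m n)"
      using that f g by (simp add: cp_quadD(8) N.add_add_A)
    have **: "mbr N (f m \<oplus>\<^bsub>N\<^esub> g m) (f n \<oplus>\<^bsub>N\<^esub> g n) x
        = mbr N (f m) (f n) x \<oplus>\<^bsub>N\<^esub> mbr N (g m) (g n) x
          \<oplus>\<^bsub>N\<^esub> (mbr N (g m) (f n) x \<oplus>\<^bsub>N\<^esub> mbr N (f m) (g n) x)"
      using that f g by (simp add: N.mbr_add1 N.mbr_add2 N.A_ac)
    show ?thesis unfolding * ** using that f g by (simp add: N.add.m_assoc)
  qed
qed (use f g in simp_all)

lemma quad_act:
  assumes f: "cp_quad R M A N B f" and r: "r \<in> carrier R"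
  shows "cp_quad R M A N B (\<lambda>m. mact N (f m) r)"
proof -
  have "\<forall>s\<in>carrier R. \<exists>x\<in>carrier (ee R). \<forall>n\<in>carrier N.
    mact N (mact N n s) r = mact N (mact N n r) s \<oplus>\<^bsub>N\<^esub> mbr N n n x"
    using N.act_commute_br r by blast
  then have "\<exists>w. \<forall>s\<in>carrier R. w s \<in> carrier (ee R) \<and> (\<forall>n\<in>carrier N.
    mact N (mact N n s) r = mact N (mact N n r) s \<oplus>\<^bsub>N\<^esub> mbr N n n (w s))"
    unfolding Bex_def by (rule bchoice)
  then obtain w where w: "\<And>s. s \<in> carrier R \<Longrightarrow> w s \<in> carrier (ee R)"
    "\<And>s n. \<lbrakk>s \<in> carrier R; n \<in> carrier N\<rbrakk>
      \<Longrightarrow> mact N (mact N n s) r = mact N (mact N n r) s \<oplus>\<^bsub>N\<^esub> mbr N n n (w s)"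
    by blast
  show ?thesis
  proof (rule quadI[where
        D = "\<lambda>m n. mbr N (f m) (f n) (sqH R r) \<oplus>\<^bsub>N\<^esub> mact N (dev M N f m n) r"
        and E = "\<lambda>s m. mbr N (f m) (f m) (w s) \<oplus>\<^bsub>N\<^esub> mact N (dev_act M N f s m) r"
        and F = "\<lambda>x m n. \<ominus>\<^bsub>N\<^esub> mact N (mact N (mbr N (f m) (f n) x) r) r
          \<oplus>\<^bsub>N\<^esub> (mact N (mbr N (f m) (f n) x) r \<oplus>\<^bsub>N\<^esub> mact N (dev_br M N f x m n) r)"])
    show "cp_bihom R M A N B (\<lambda>m n. mbr N (f m) (f n) (sqH R r) \<oplus>\<^bsub>N\<^esub> mact N (dev M N f m n) r)"
      using r by (intro bihom_add bihom_act bihom_br cp_quadD(3) f) simp_all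
    show "cp_hom2 R M A N B (\<lambda>m. mbr N (f m) (f m) (w s) \<oplus>\<^bsub>N\<^esub> mact N (dev_act M N f s m) r)"
      if "s \<in> carrier R" for s
      using that r w by (intro hom2_add hom2_act bihom_diag[OF bihom_br] cp_quadD(5) f) simp_all
    show "cp_bihom R M A N B (\<lambda>m n. \<ominus>\<^bsub>N\<^esub> mact N (mact N (mbr N (f m) (f n) x) r) r
        \<oplus>\<^bsub>N\<^esub> (mact N (mbr N (f m) (f n) x) r \<oplus>\<^bsub>N\<^esub> mact N (dev_br M N f x m n) r))"
      if "x \<in> carrier (ee R)" for x
      using that r by (intro bihom_add bihom_minus bihom_act bihom_br cp_quadD(7) f) simp_all
    show "mact N (f (m \<oplus>\<^bsub>M\<^esub> n)) r = mact N (f m) r \<oplus>\<^bsub>N\<^esub> mact N (f n) r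
        \<oplus>\<^bsub>N\<^esub> (mbr N (f m) (f n) (sqH R r) \<oplus>\<^bsub>N\<^esub> mact N (dev M N f m n) r)"
      if "m \<in> carrier M" "n \<in> carrier M" for m n
      using that r f by (simp add: cp_quadD(4) N.add_act_A) (simp add: N.add_mact N.add.m_assoc)
    show "mact N (f (mact M m s)) r = mact N (mact N (f m) r) s
        \<oplus>\<^bsub>N\<^esub> (mbr N (f m) (f m) (w s) \<oplus>\<^bsub>N\<^esub> mact N (dev_act M N f s m) r)"
      if "s \<in> carrier R" "m \<in> carrier M" for s m
      using that r f w by (simp add: cp_quadD(6) N.add_act_A N.add.m_assoc)
    show "mact N (f (mbr M m n x)) r = mbr N (mact N (f m) r) (mact N (f n) r) x
        \<oplus>\<^bsub>N\<^esub> (\<ominus>\<^bsub>N\<^esub> mact N (mact N (mbr N (f m) (f n) x) r) r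
        \<oplus>\<^bsub>N\<^esub> (mact N (mbr N (f m) (f n) x) r \<oplus>\<^bsub>N\<^esub> mact N (dev_br M N f x m n) r))"
      if "x \<in> carrier (ee R)" "m \<in> carrier M" "n \<in> carrier M" for x m n
      using that r f by (simp add: cp_quadD(8) N.add_act_A N.br_act1 N.br_act2)
  qed (use f r in simp_all)
qed

lemma quad_br:
  assumes f: "cp_quad R M A N B f" and g: "cp_quad R M A N B g" and x: "x \<in> carrier (ee R)"
  shows "cp_quad R M A N B (\<lambda>m. mbr N (f m) (g m) x)"
proof (rule quadI[where D = "\<lambda>m n. mbr N (f m) (g n) x \<oplus>\<^bsub>N\<^esub> mbr N (f n) (g m) x"
      and E = "\<lambda>r m. \<ominus>\<^bsub>N\<^esub> mact N (mbr N (f m) (g m) x) r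
        \<oplus>\<^bsub>N\<^esub> mact N (mact N (mbr N (f m) (g m) x) r) r"
      and F = "\<lambda>y m n. \<zero>\<^bsub>N\<^esub>"])
  show "cp_bihom R M A N B (\<lambda>m n. mbr N (f m) (g n) x \<oplus>\<^bsub>N\<^esub> mbr N (f n) (g m) x)"
    by (intro bihom_add bihom_br bihom_flip[OF bihom_br] f g x)
  show "cp_hom2 R M A N B (\<lambda>m. \<ominus>\<^bsub>N\<^esub> mact N (mbr N (f m) (g m) x) r
        \<oplus>\<^bsub>N\<^esub> mact N (mact N (mbr N (f m) (g m) x) r) r)" if "r \<in> carrier R" for r
    using bihom_diag[OF bihom_add[OF bihom_minus[OF bihom_act[OF bihom_br[OF f g x] that]]
        bihom_act[OF bihom_act[OF bihom_br[OF f g x] that] that]]] .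
  show "mbr N (f (m \<oplus>\<^bsub>M\<^esub> n)) (g (m \<oplus>\<^bsub>M\<^esub> n)) x = mbr N (f m) (g m) x \<oplus>\<^bsub>N\<^esub> mbr N (f n) (g n) x
      \<oplus>\<^bsub>N\<^esub> (mbr N (f m) (g n) x \<oplus>\<^bsub>N\<^esub> mbr N (f n) (g m) x)"
    if "m \<in> carrier M" "n \<in> carrier M" for m n
    using that f g x by (simp add: cp_quadD(4) N.mbr_add1 N.mbr_add2 N.A_ac)
  show "mbr N (f (mact M m r)) (g (mact M m r)) x = mact N (mbr N (f m) (g m) x) r
      \<oplus>\<^bsub>N\<^esub> (\<ominus>\<^bsub>N\<^esub> mact N (mbr N (f m) (g m) x) r
        \<oplus>\<^bsub>N\<^esub> mact N (mact N (mbr N (f m) (g m) x) r) r)"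
    if "r \<in> carrier R" "m \<in> carrier M" for r m
    using that f g x by (simp add: cp_quadD(6) N.mbr_add1 N.mbr_add2 N.br_act1 N.br_act2)
qed (use f g x bihom_zero in simp_all)

lemma quad_minus:
  assumes "cp_quad R M A N B f"
  shows "cp_quad R M A N B (\<lambda>m. \<ominus>\<^bsub>N\<^esub> f m)"
  using quad_act[OF assms M.R_minus_closed[OF M.R_one_closed]] assms
    quad_cong[of "\<lambda>m. mact N (f m) (\<ominus> \<one>)" "\<lambda>m. \<ominus>\<^bsub>N\<^esub> f m"]
  by (simp add: N.act_minus_one)

lemma quad_difference:
  assumes "cp_quad R M A N B f" "cp_quad R M A N B g"
    and "\<And>m. m \<in> carrier M \<Longrightarrow> h m \<in> carrier N"
    and "\<And>m. m \<in> carrier M \<Longrightarrow> g m = f m \<oplus>\<^bsub>N\<^esub> h m"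
  shows "cp_quad R M A N B h"
  using quad_add[OF quad_minus[OF assms(1)] assms(2)] assms
    quad_cong[of "\<lambda>m. \<ominus>\<^bsub>N\<^esub> f m \<oplus>\<^bsub>N\<^esub> g m" h]
  by (simp add: N.minus_add_cancel)

lemma quad_add_A:
  assumes "cp_quad R M A N B f" "m \<in> carrier M" "a \<in> A"
  shows "f (m \<oplus>\<^bsub>M\<^esub> a) = f m \<oplus>\<^bsub>N\<^esub> f a"
  using assms cp_quadD(3,4)[OF assms(1)] by (simp add: cp_bihom_def)

lemma quad_act_A:
  assumes "cp_quad R M A N B f" "a \<in> A" "r \<in> carrier R"
  shows "f (mact M a r) = mact N (f a) r"
  using assms cp_quadD(5,6)[OF assms(1)] by (simp add: cp_hom2_def)

lemma quad_zero_value: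
  assumes "cp_quad R M A N B f"
  shows "f \<zero>\<^bsub>M\<^esub> = \<zero>\<^bsub>N\<^esub>"
  using quad_add_A[OF assms, of "\<zero>\<^bsub>M\<^esub>" "\<zero>\<^bsub>M\<^esub>"] assms by simp

lemma dev_act_add_A:
  assumes f: "cp_quad R M A N B f" and "m \<in> carrier M" "a \<in> A" "r \<in> carrier R"
  shows "dev_act M N f r (m \<oplus>\<^bsub>M\<^esub> a) = dev_act M N f r m"
proof -
  have "f (mact M (m \<oplus>\<^bsub>M\<^esub> a) r) = mact N (f m) r \<oplus>\<^bsub>N\<^esub> mact N (f a) r \<oplus>\<^bsub>N\<^esub> dev_act M N f r (m \<oplus>\<^bsub>M\<^esub> a)"
    using assms cp_quadD(6)[OF f, of "m \<oplus>\<^bsub>M\<^esub> a" r] by (simp add: quad_add_A N.add_act_A)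
  moreover have "f (mact M (m \<oplus>\<^bsub>M\<^esub> a) r) = mact N (f m) r \<oplus>\<^bsub>N\<^esub> (dev_act M N f r m \<oplus>\<^bsub>N\<^esub> mact N (f a) r)"
    using assms cp_quadD(6)[OF f, of m r]
    by (simp add: M.add_act_A quad_add_A quad_act_A N.add.m_assoc)
  moreover have "dev_act M N f r m \<oplus>\<^bsub>N\<^esub> mact N (f a) r = mact N (f a) r \<oplus>\<^bsub>N\<^esub> dev_act M N f r m"
    using assms by (intro N.A_commute) simp_all
  ultimately show ?thesis
    using assms N.left_cancel[of "mact N (f m) r \<oplus>\<^bsub>N\<^esub> mact N (f a) r"] by (simp flip: N.add.m_assoc)
qed

end

locale cp_mod_triple = MN: cp_mod_pair R M A N B + NL: cp_mod_pair R N B L C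
  for R :: "('r, 'x, 'e) sqring_scheme" (structure)
    and M :: "('m, 'r, 'x, 'f) bhp_scheme" and A :: "'m set"
    and N :: "('n, 'r, 'x, 'g) bhp_scheme" and B :: "'n set"
    and L :: "('l, 'r, 'x, 'h) bhp_scheme" and C :: "'l set"

sublocale cp_mod_triple \<subseteq> K: cp_mod_pair R M A L C
  by unfold_locales

context cp_mod_triple
begin

lemma bihom_comp_left:
  assumes f: "cp_quad R M A N B f" and D: "cp_bihom R N B L C D"
  shows "cp_bihom R M A L C (\<lambda>m n. D (f m) (f n))"
proof -
  have C: "D p q \<in> C" if "p \<in> carrier N" "q \<in> carrier N" for p q
    using D that by (simp add: cp_bihom_def)
  have add: "D (p \<oplus>\<^bsub>N\<^esub> p') q = D p q \<oplus>\<^bsub>L\<^esub> D p' q" "D q (p \<oplus>\<^bsub>N\<^esub> p') = D q p \<oplus>\<^bsub>L\<^esub> D q p'"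
    if "p \<in> carrier N" "p' \<in> carrier N" "q \<in> carrier N" for p p' q
    using D that by (simp_all add: cp_bihom_def)
  have act: "D (mact N p r) q = mact L (D p q) r" "D q (mact N p r) = mact L (D q p) r"
    if "p \<in> carrier N" "q \<in> carrier N" "r \<in> carrier R" for p q r
    using D that by (simp_all add: cp_bihom_def)
  have zero: "D p b = \<zero>\<^bsub>L\<^esub>" "D b p = \<zero>\<^bsub>L\<^esub>" if "p \<in> carrier N" "b \<in> B" for p b
    using D that by (simp_all add: cp_bihom_def)
  show ?thesis
    unfolding cp_bihom_def using f by (simp add: C add act zero MN.cp_quadD(4,6))
qed

lemma bihom_comp_right:
  assumes D: "cp_bihom R M A N B D" and h: "cp_quad R N B L C h"
  shows "cp_bihom R M A L C (\<lambda>m n. h (D m n))"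
  using D h unfolding cp_bihom_def
  by (simp add: NL.quad_add_A NL.quad_act_A NL.quad_zero_value)

lemma hom2_comp_left:
  assumes f: "cp_quad R M A N B f" and h: "cp_quad R N B L C h" and r: "r \<in> carrier R"
  shows "cp_hom2 R M A L C (\<lambda>m. dev_act N L h r (f m))"
  using NL.cp_quadD(5)[OF h r] f h r
  by (simp add: cp_hom2_def MN.cp_quadD(6) NL.dev_act_add_A)

lemma hom2_comp_right:
  assumes E: "cp_hom2 R M A N B E" and h: "cp_quad R N B L C h"
  shows "cp_hom2 R M A L C (\<lambda>m. h (E m))"
  using E h by (simp add: cp_hom2_def NL.quad_act_A NL.quad_zero_value)

lemma quad_comp:
  assumes f: "cp_quad R M A N B f" and h: "cp_quad R N B L C h"
  shows "cp_quad R M A L C (\<lambda>m. h (f m))"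
proof (rule K.quadI[where D = "\<lambda>m n. dev N L h (f m) (f n) \<oplus>\<^bsub>L\<^esub> h (dev M N f m n)"
      and E = "\<lambda>r m. dev_act N L h r (f m) \<oplus>\<^bsub>L\<^esub> h (dev_act M N f r m)"
      and F = "\<lambda>x m n. dev_br N L h x (f m) (f n) \<oplus>\<^bsub>L\<^esub> h (dev_br M N f x m n)"])
  show "cp_bihom R M A L C (\<lambda>m n. dev N L h (f m) (f n) \<oplus>\<^bsub>L\<^esub> h (dev M N f m n))"
    by (intro K.bihom_add bihom_comp_left bihom_comp_right MN.cp_quadD(3) NL.cp_quadD(3) f h)
  show "cp_hom2 R M A L C (\<lambda>m. dev_act N L h r (f m) \<oplus>\<^bsub>L\<^esub> h (dev_act M N f r m))"
    if "r \<in> carrier R" for r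
    by (intro K.hom2_add hom2_comp_left hom2_comp_right MN.cp_quadD(5) f h that)
  show "cp_bihom R M A L C (\<lambda>m n. dev_br N L h x (f m) (f n) \<oplus>\<^bsub>L\<^esub> h (dev_br M N f x m n))"
    if "x \<in> carrier (ee R)" for x
    by (intro K.bihom_add bihom_comp_left bihom_comp_right MN.cp_quadD(7) NL.cp_quadD(7) f h that)
qed (use f h in \<open>simp_all add: MN.cp_quadD(4,6,8) NL.quad_add_A NL.cp_quadD(4,6,8) NL.N.add.m_assoc\<close>)

end

context cp_mod_pair
begin

definition Q where "Q = fst (Quad R (M, A) (N, B))"
definition S where "S = snd (Quad R (M, A) (N, B))"

lemma Quad_eq: "Quad R (M, A) (N, B) = (Q, S)"
  by (simp add: Q_def S_def del: Quad.simps)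

lemma carrier_Q: "carrier Q = {f \<in> extensional (carrier M). cp_quad R M A N B f}"
  by (simp add: Q_def cp_quadratic_iff_quad del: cp_quadratic.simps)

lemma Q_simps [simp]:
  "zero Q = (\<lambda>m\<in>carrier M. \<zero>\<^bsub>N\<^esub>)"
  "add Q f g = (\<lambda>m\<in>carrier M. f m \<oplus>\<^bsub>N\<^esub> g m)"
  "mact Q f r = (\<lambda>m\<in>carrier M. mact N (f m) r)"
  "mbr Q f g x = (\<lambda>m\<in>carrier M. mbr N (f m) (g m) x)"
  by (simp_all add: Q_def)

lemma S_eq: "S = {f \<in> carrier Q. f ` carrier M \<subseteq> B \<and> f ` A \<subseteq> {\<zero>\<^bsub>N\<^esub>}}"
  by (simp add: S_def Q_def)

lemma restrict_Q [simp]: "restrict f (carrier M) \<in> carrier Q \<longleftrightarrow> cp_quad R M A N B f"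
  using quad_cong[of "restrict f (carrier M)" f] by (simp add: carrier_Q)

lemma Q_quad: "f \<in> carrier Q \<Longrightarrow> cp_quad R M A N B f"
  by (simp add: carrier_Q)

lemma Q_value [simp]: "\<lbrakk>f \<in> carrier Q; m \<in> carrier M\<rbrakk> \<Longrightarrow> f m \<in> carrier N"
  using Q_quad by simp

lemma Q_value_A [simp]: "\<lbrakk>f \<in> carrier Q; a \<in> A\<rbrakk> \<Longrightarrow> f a \<in> B"
  using Q_quad by simp

lemma Q_restrict: "f \<in> carrier Q \<Longrightarrow> restrict f (carrier M) = f"
  by (simp add: carrier_Q extensional_restrict)

lemma Q_closed:
  "zero Q \<in> carrier Q"
  "\<lbrakk>f \<in> carrier Q; g \<in> carrier Q\<rbrakk> \<Longrightarrow> add Q f g \<in> carrier Q"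
  "\<lbrakk>f \<in> carrier Q; r \<in> carrier R\<rbrakk> \<Longrightarrow> mact Q f r \<in> carrier Q"
  "\<lbrakk>f \<in> carrier Q; g \<in> carrier Q; x \<in> carrier (ee R)\<rbrakk> \<Longrightarrow> mbr Q f g x \<in> carrier Q"
  "f \<in> carrier Q \<Longrightarrow> (\<lambda>m\<in>carrier M. \<ominus>\<^bsub>N\<^esub> f m) \<in> carrier Q"
  by (simp_all add: quad_zero quad_add quad_act quad_br quad_minus Q_quad)

lemma Q_group: "group (add_monoid Q)"
proof (rule groupI)
  fix f assume f: "f \<in> carrier (add_monoid Q)"
  show "\<exists>g\<in>carrier (add_monoid Q). g \<otimes>\<^bsub>add_monoid Q\<^esub> f = \<one>\<^bsub>add_monoid Q\<^esub>"
    using f Q_closed(5)[of f]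
    by (intro bexI[of _ "\<lambda>m\<in>carrier M. \<ominus>\<^bsub>N\<^esub> f m"]) (auto intro!: restrict_ext)
  show "\<one>\<^bsub>add_monoid Q\<^esub> \<otimes>\<^bsub>add_monoid Q\<^esub> f = f"
  proof -
    have "zero Q \<oplus>\<^bsub>Q\<^esub> f = restrict f (carrier M)" using f by (auto intro!: restrict_ext)
    then show ?thesis using f Q_restrict[of f] by simp
  qed
qed (use Q_closed(1,2) in \<open>auto intro!: restrict_ext simp: N.add.m_assoc\<close>)

lemma Q_minus:
  assumes "f \<in> carrier Q"
  shows "\<ominus>\<^bsub>Q\<^esub> f = (\<lambda>m\<in>carrier M. \<ominus>\<^bsub>N\<^esub> f m)"
proof -
  interpret Q: group "add_monoid Q" by (rule Q_group)
  have "(\<lambda>m\<in>carrier M. \<ominus>\<^bsub>N\<^esub> f m) \<otimes>\<^bsub>add_monoid Q\<^esub> f = \<one>\<^bsub>add_monoid Q\<^esub>"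
    using assms by (auto intro!: restrict_ext)
  then show ?thesis
    unfolding a_inv_def[of Q] using assms Q_closed(5)[of f] by (intro Q.inv_equality) simp_all
qed

lemma Q_bhp: "bhp_module R Q"
proof (intro bhp_module.intro bhp_module_axioms.intro)
  show "square_ring R" by (rule M.square_ring_axioms)
  show "group (add_monoid Q)" by (rule Q_group)
  show "mact Q f \<one> = f" if "f \<in> carrier Q" for f
  proof -
    have "mact Q f \<one> = restrict f (carrier M)"
      using that by (auto intro!: restrict_ext simp: N.mact_one)
    then show ?thesis using that Q_restrict by simp
  qed
  show "mact Q (mact Q f r) s = mact Q f (r \<otimes> s)"
    if "f \<in> carrier Q" "r \<in> carrier R" "s \<in> carrier R" for f r s
    using that by (auto intro!: restrict_ext simp: N.mact_mult)
  show "mact Q f (r \<oplus> s) = mact Q f r \<oplus>\<^bsub>Q\<^esub> mact Q f s"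
    if "f \<in> carrier Q" "r \<in> carrier R" "s \<in> carrier R" for f r s
    using that by (auto intro!: restrict_ext simp: N.mact_add)
  show "mact Q (f \<oplus>\<^bsub>Q\<^esub> g) r = mact Q f r \<oplus>\<^bsub>Q\<^esub> mact Q g r \<oplus>\<^bsub>Q\<^esub> mbr Q f g (sqH R r)"
    if "f \<in> carrier Q" "g \<in> carrier Q" "r \<in> carrier R" for f g r
    using that by (auto intro!: restrict_ext simp: N.add_mact)
  show "mact Q f (sqP R x) = mbr Q f f x" if "f \<in> carrier Q" "x \<in> carrier (ee R)" for f x
    using that by (auto intro!: restrict_ext simp: N.mact_P)
  show "mbr Q f g (sqT R x) = mbr Q g f x"
    if "f \<in> carrier Q" "g \<in> carrier Q" "x \<in> carrier (ee R)" for f g x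
    using that by (auto intro!: restrict_ext simp: N.mbr_T)
  show "mbr Q (f \<oplus>\<^bsub>Q\<^esub> f') g x = mbr Q f g x \<oplus>\<^bsub>Q\<^esub> mbr Q f' g x"
    if "f \<in> carrier Q" "f' \<in> carrier Q" "g \<in> carrier Q" "x \<in> carrier (ee R)" for f f' g x
    using that by (auto intro!: restrict_ext simp: N.mbr_add1)
  show "mbr Q f (g \<oplus>\<^bsub>Q\<^esub> g') x = mbr Q f g x \<oplus>\<^bsub>Q\<^esub> mbr Q f g' x"
    if "f \<in> carrier Q" "g \<in> carrier Q" "g' \<in> carrier Q" "x \<in> carrier (ee R)" for f g g' x
    using that by (auto intro!: restrict_ext simp: N.mbr_add2)
  show "mbr Q f g (x \<oplus>\<^bsub>ee R\<^esub> x') = mbr Q f g x \<oplus>\<^bsub>Q\<^esub> mbr Q f g x'"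
    if "f \<in> carrier Q" "g \<in> carrier Q" "x \<in> carrier (ee R)" "x' \<in> carrier (ee R)" for f g x x'
    using that by (auto intro!: restrict_ext simp: N.mbr_add3)
  show "mact Q (mbr Q (mact Q f r) (mact Q g s) x) t = mbr Q f g (act R r s x t)"
    if "f \<in> carrier Q" "g \<in> carrier Q" "r \<in> carrier R" "s \<in> carrier R" "x \<in> carrier (ee R)"
      "t \<in> carrier R" for f g r s x t
    using that by (auto intro!: restrict_ext simp: N.mbr_act)
  show "mbr Q (mbr Q f f' x) g y = \<zero>\<^bsub>Q\<^esub>"
    if "f \<in> carrier Q" "f' \<in> carrier Q" "g \<in> carrier Q" "x \<in> carrier (ee R)" "y \<in> carrier (ee R)"
    for f f' g x y
    using that by (auto intro!: restrict_ext)
qed (use Q_closed in \<open>simp_all only:\<close>)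

lemma S_iff:
  "f \<in> S \<longleftrightarrow> f \<in> carrier Q \<and> (\<forall>m\<in>carrier M. f m \<in> B) \<and> (\<forall>a\<in>A. f a = \<zero>\<^bsub>N\<^esub>)"
  by (auto simp: S_eq)

lemma Q_cp: "cp_module R (Q, S)"
proof -
  interpret Q: bhp_module R Q by (rule Q_bhp)
  have "subgroup S (add_monoid Q)"
  proof (rule group.subgroupI[OF Q_group])
    have "zero Q \<in> S" unfolding S_iff using Q_closed(1) by auto
    then show "S \<noteq> {}" by blast
    fix f assume f: "f \<in> S"
    have "\<ominus>\<^bsub>Q\<^esub> f \<in> S"
      using f Q_closed(5)[of f] Q_minus[of f] unfolding S_iff by auto
    then show "inv\<^bsub>add_monoid Q\<^esub> f \<in> S" by (simp add: a_inv_def)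
    fix g assume g: "g \<in> S"
    show "f \<otimes>\<^bsub>add_monoid Q\<^esub> g \<in> S"
      using f g Q_closed(2)[of f g] unfolding S_iff by auto
  qed (auto simp: S_iff)
  moreover have "mact Q f r \<in> S" if "f \<in> S" "r \<in> carrier R" for f r
    using that Q_closed(3)[of f r] unfolding S_iff by auto
  moreover have "mbr Q f g x = \<zero>\<^bsub>Q\<^esub>" if "f \<in> S" "g \<in> carrier Q" "x \<in> carrier (ee R)" for f g x
    using that by (auto simp: S_iff intro!: restrict_ext)
  moreover have "mbr Q f g x \<in> S"
    if "f \<in> carrier Q" "g \<in> carrier Q" "x \<in> carrier (ee R)" for f g x
    using that Q_closed(4)[of f g x] unfolding S_iff by auto
  ultimately show ?thesis
    using Q_bhp by (simp add: additive_subgroup_def del: Q_simps)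
qed

end

context cp_mod_triple
begin

lemma bihom_pointwise:
  assumes D: "cp_bihom R N B L C D"
    and quad: "\<And>h k. \<lbrakk>h \<in> carrier MN.Q; k \<in> carrier MN.Q\<rbrakk>
      \<Longrightarrow> cp_quad R M A L C (\<lambda>m. D (h m) (k m))"
  shows "cp_bihom R MN.Q MN.S K.Q K.S (\<lambda>h k. \<lambda>m\<in>carrier M. D (h m) (k m))"
proof -
  have C: "D p q \<in> C" if "p \<in> carrier N" "q \<in> carrier N" for p q
    using D that by (simp add: cp_bihom_def)
  have add: "D (p \<oplus>\<^bsub>N\<^esub> p') q = D p q \<oplus>\<^bsub>L\<^esub> D p' q" "D q (p \<oplus>\<^bsub>N\<^esub> p') = D q p \<oplus>\<^bsub>L\<^esub> D q p'"
    if "p \<in> carrier N" "p' \<in> carrier N" "q \<in> carrier N" for p p' q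
    using D that by (simp_all add: cp_bihom_def)
  have act: "D (mact N p r) q = mact L (D p q) r" "D q (mact N p r) = mact L (D q p) r"
    if "p \<in> carrier N" "q \<in> carrier N" "r \<in> carrier R" for p q r
    using D that by (simp_all add: cp_bihom_def)
  have zero: "D p b = \<zero>\<^bsub>L\<^esub>" "D b p = \<zero>\<^bsub>L\<^esub>" if "p \<in> carrier N" "b \<in> B" for p b
    using D that by (simp_all add: cp_bihom_def)
  show ?thesis
    unfolding cp_bihom_def
  proof (intro conjI ballI)
    show "(\<lambda>m\<in>carrier M. D (h m) (k m)) \<in> K.S" if "h \<in> carrier MN.Q" "k \<in> carrier MN.Q" for h k
      unfolding K.S_iff using that quad by (simp add: C zero)
  qed (auto intro!: restrict_ext simp: add act zero MN.S_iff)
qed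

lemma hom2_pointwise:
  assumes E: "cp_hom2 R N B L C E"
    and quad: "\<And>h. h \<in> carrier MN.Q \<Longrightarrow> cp_quad R M A L C (\<lambda>m. E (h m))"
  shows "cp_hom2 R MN.Q MN.S K.Q K.S (\<lambda>h. \<lambda>m\<in>carrier M. E (h m))"
proof -
  have E': "\<And>p. p \<in> carrier N \<Longrightarrow> E p \<in> C" "\<And>b. b \<in> B \<Longrightarrow> E b = \<zero>\<^bsub>L\<^esub>"
    "\<And>p s. \<lbrakk>p \<in> carrier N; s \<in> carrier R\<rbrakk> \<Longrightarrow> E (mact N p s) = mact L (E p) (s \<otimes> s)"
    using E by (simp_all add: cp_hom2_def)
  show ?thesis
    unfolding cp_hom2_def
  proof (intro conjI ballI)
    show "(\<lambda>m\<in>carrier M. E (h m)) \<in> K.S" if "h \<in> carrier MN.Q" for h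
      unfolding K.S_iff using that quad by (simp add: E')
  qed (auto intro!: restrict_ext simp: E' MN.S_iff)
qed

lemma pullback_cp_linear:
  assumes f: "cp_quad R M A N B f"
  shows "cp_linear R (NL.Q, NL.S) (K.Q, K.S) (\<lambda>h. compose (carrier M) h f)"
proof -
  have Q: "compose (carrier M) h f \<in> carrier K.Q" if "h \<in> carrier NL.Q" for h
    unfolding compose_def using quad_comp[OF f NL.Q_quad[OF that]] by simp
  have "(\<lambda>h. compose (carrier M) h f) \<in> hom (add_monoid NL.Q) (add_monoid K.Q)"
    using f Q by (auto simp: hom_def compose_def intro!: restrict_ext)
  moreover have "compose (carrier M) (mact NL.Q h r) f = mact K.Q (compose (carrier M) h f) r"
    "compose (carrier M) (mbr NL.Q h h' x) f
      = mbr K.Q (compose (carrier M) h f) (compose (carrier M) h' f) x" for h h' r x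
    using f by (auto simp: compose_def intro!: restrict_ext)
  moreover have "compose (carrier M) h f \<in> K.S" if "h \<in> NL.S" for h
    using that f Q unfolding NL.S_iff K.S_iff by (simp add: compose_def)
  ultimately show ?thesis
    using NL.Q_cp K.Q_cp unfolding cp_linear.simps sq_linear_def by blast
qed

lemma pushforward_cp_quadratic:
  assumes g: "cp_quad R N B L C g"
  shows "cp_quadratic R (MN.Q, MN.S) (K.Q, K.S) (\<lambda>h. compose (carrier M) g h)"
proof -
  interpret quad: cp_mod_pair R MN.Q MN.S K.Q K.S
    using MN.Q_cp K.Q_cp MN.M.comm_square_ring_axioms
    by (intro cp_mod_pair.intro cp_mod.intro cp_mod_axioms.intro)
  note comp = quad_comp[OF MN.Q_quad g]
  have dev: "cp_quad R M A L C (\<lambda>m. dev N L g (h m) (k m))"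
    if "h \<in> carrier MN.Q" "k \<in> carrier MN.Q" for h k
    by (rule K.quad_difference[OF K.quad_add[OF comp[OF that(1)] comp[OF that(2)]]
          quad_comp[OF MN.quad_add[OF MN.Q_quad[OF that(1)] MN.Q_quad[OF that(2)]] g]])
      (use that g in \<open>simp_all add: NL.cp_quadD(4)\<close>)
  have dev_act: "cp_quad R M A L C (\<lambda>m. dev_act N L g r (h m))"
    if "h \<in> carrier MN.Q" "r \<in> carrier R" for h r
    by (rule K.quad_difference[OF K.quad_act[OF comp[OF that(1)] that(2)]
          quad_comp[OF MN.quad_act[OF MN.Q_quad[OF that(1)] that(2)] g]])
      (use that g in \<open>simp_all add: NL.cp_quadD(6)\<close>)
  have dev_br: "cp_quad R M A L C (\<lambda>m. dev_br N L g x (h m) (k m))"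
    if "h \<in> carrier MN.Q" "k \<in> carrier MN.Q" "x \<in> carrier (ee R)" for h k x
    by (rule K.quad_difference[OF K.quad_br[OF comp[OF that(1)] comp[OF that(2)] that(3)]
          quad_comp[OF MN.quad_br[OF MN.Q_quad[OF that(1)] MN.Q_quad[OF that(2)] that(3)] g]])
      (use that g in \<open>simp_all add: NL.cp_quadD(8)\<close>)
  show ?thesis
    unfolding quad.cp_quadratic_iff_quad
  proof (rule quad.quadI[where D = "\<lambda>h k. \<lambda>m\<in>carrier M. dev N L g (h m) (k m)"
        and E = "\<lambda>r h. \<lambda>m\<in>carrier M. dev_act N L g r (h m)"
        and F = "\<lambda>x h k. \<lambda>m\<in>carrier M. dev_br N L g x (h m) (k m)"])
    show "compose (carrier M) g h \<in> carrier K.Q" if "h \<in> carrier MN.Q" for h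
      unfolding compose_def using comp[OF that] by simp
    show "compose (carrier M) g h \<in> K.S" if "h \<in> MN.S" for h
      using that comp g unfolding K.S_iff MN.S_iff
      by (simp add: compose_def NL.quad_zero_value)
    show "cp_bihom R MN.Q MN.S K.Q K.S (\<lambda>h k. \<lambda>m\<in>carrier M. dev N L g (h m) (k m))"
      using dev by (intro bihom_pointwise NL.cp_quadD(3) g)
    show "cp_hom2 R MN.Q MN.S K.Q K.S (\<lambda>h. \<lambda>m\<in>carrier M. dev_act N L g r (h m))"
      if "r \<in> carrier R" for r
      using that dev_act by (intro hom2_pointwise NL.cp_quadD(5) g)
    show "cp_bihom R MN.Q MN.S K.Q K.S (\<lambda>h k. \<lambda>m\<in>carrier M. dev_br N L g x (h m) (k m))"
      if "x \<in> carrier (ee R)" for x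
      using that dev_br by (intro bihom_pointwise NL.cp_quadD(7) g)
  qed (use g in \<open>auto simp: compose_def NL.cp_quadD(4,6,8) intro!: restrict_ext\<close>)
qed

end

theorem proposition3p3p4:
  fixes R :: "('r, 'x, 'e) sqring_scheme"
    and M :: "('m, 'r, 'x, 'f) bhp_scheme" and A :: "'m set"
    and N :: "('n, 'r, 'x, 'g) bhp_scheme" and B :: "'n set"
    and L :: "('l, 'r, 'x, 'h) bhp_scheme" and C :: "'l set"
    and f :: "'m \<Rightarrow> 'n" and g :: "'n \<Rightarrow> 'l"
  assumes "comm_square_ring R"
    and "cp_module R (M, A)" and "cp_module R (N, B)" and "cp_module R (L, C)"
    and "cp_quadratic R (M, A) (N, B) f"
    and "cp_quadratic R (N, B) (L, C) g"
  shows "cp_linear R (Quad R (N, B) (L, C)) (Quad R (M, A) (L, C))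
           (\<lambda>h. compose (carrier M) h f) \<and>
         cp_quadratic R (Quad R (M, A) (N, B)) (Quad R (M, A) (L, C))
           (\<lambda>h. compose (carrier M) g h)"
proof -
  interpret cp_mod_triple R M A N B L C
    using assms(1-4) by (intro cp_mod_triple.intro cp_mod_pair.intro cp_mod.intro cp_mod_axioms.intro)
  show ?thesis
    using pullback_cp_linear pushforward_cp_quadratic assms(5,6)
    unfolding MN.cp_quadratic_iff_quad NL.cp_quadratic_iff_quad MN.Quad_eq NL.Quad_eq K.Quad_eq
    by blast
qed

end
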